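(* Let $V_1,V_2$ be models of $ZF$ such that $V_2$ is a set of $V_1$, and let $f:\omega(V_1)\to\omega(V_2)$ be a map such that $V_2$ initial-segment number extends $V_1$ using $f$. Let $T$ be an effective set of axioms which is consistent according to both $\omega(V_1)$ and $\omega(V_2)$, and let $T_1\in\omega(V_1)$ be a code of a Turing machine recognizing $T$. Let $\mathcal{L}_1(T_1)$ be $\mathcal{L}(T)$ computed in $V_1$ (using the code $T_1$) and $\mathcal{L}_2(f(T_1))$ be $\mathcal{L}(T)$ computed in $V_2$ (using the code $f(T_1)$). Then $f(\mathcal{L}_1(T_1))=\mathcal{L}_2(f(T_1))$.
   Context: For a model $M$ of $ZF$, $\omega(M)$ denotes the $\omega$ of $M$ (least set containing $\emptyset$ and closed under $x\mapsto x\cup\{x\}$, computed in $M$). A model $V_2$ of $ZF$ is a set of $V_1$ if $V_2$ is a set within $V_1$, all sets of $V_2$ are sets of $V_1$, and $\in_{V_2}$ (as a set of pairs) is a set of $V_1$. $V_2$ initial-segment number extends $V_1$ using $f$ if $f$ preserves $+,\cdot$, exponentiation, $0$ and $1$ (each computed in the respective model), and for every $b\in\omega(V_1)$ and $a\in\omega(V_2)$ with $a<_2 f(b)$ there is $c\in\omega(V_1)$ with $a=f(c)$. Fix a universal coding of Turing machines; $Kol(x)$ is the least code of a Turing machine printing $x$. For a given $L$, consider the Turing machine that runs over the natural numbers $y$ in increasing order, checks whether $y$ is a proof from $T$ of a statement of the form $L\le Kol(x)$, and if so halts and prints $x$; its code has size $\log(L)+C$, where $\log(L)$ is the length of the decimal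 representation of $L$ and $C$ is a fixed constant accounting for the representation of (a machine recognizing) $T$ and the rest of this machine's operation. $\mathcal{L}(T)$ is defined as the minimal number $L$ such that $L>\log(L)+C$. *)

theory Defs
  imports Main
begin

section \<open>First-order formulas and their satisfaction\<close>

text \<open>
  A countable relational language with equality. Besides membership it has symbols for the graphs
  of the arithmetical operations and infinitely many further symbols (function symbols are
  represented by their graphs), so that both arithmetical and set theories are theories in it.
  The arity of an atom is the length of its argument list.
\<close>

datatype symb = Mem | Nat | Zero | Succ | Add | Mul | Exp | Other nat

datatype fm =
    Eq nat nat
  | Rel symb "nat list"
  | Neg fm
  | Imp fm fm
  | All nat fm

primrec symbols :: "fm \<Rightarrow> symb set" where
  "symbols (Eq i j) = {}"
| "symbols (Rel r is) = {r}"
| "symbols (Neg A) = symbols A"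
| "symbols (Imp A B) = symbols A \<union> symbols B"
| "symbols (All i A) = symbols A"

primrec free_vars :: "fm \<Rightarrow> nat set" where
  "free_vars (Eq i j) = {i, j}"
| "free_vars (Rel r is) = set is"
| "free_vars (Neg A) = free_vars A"
| "free_vars (Imp A B) = free_vars A \<union> free_vars B"
| "free_vars (All i A) = free_vars A - {i}"

primrec sat :: "'a set \<Rightarrow> (symb \<Rightarrow> 'a list \<Rightarrow> bool) \<Rightarrow> (nat \<Rightarrow> 'a) \<Rightarrow> fm \<Rightarrow> bool" where
  "sat D I v (Eq i j) \<longleftrightarrow> v i = v j"
| "sat D I v (Rel r is) \<longleftrightarrow> I r (map v is)"
| "sat D I v (Neg A) \<longleftrightarrow> \<not> sat D I v A"
| "sat D I v (Imp A B) \<longleftrightarrow> (sat D I v A \<longrightarrow> sat D I v B)"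
| "sat D I v (All i A) \<longleftrightarrow> (\<forall>a\<in>D. sat D I (v(i := a)) A)"


section \<open>Computability and provability over a structure of natural numbers\<close>

text \<open>
  Everything in this section is arithmetical and is relative to a structure \<open>N\<close>, which will be
  the \<open>\<omega>\<close> of a model of ZF and may be nonstandard. Hence no inductive definitions or
  recursions of the metatheory occur here, except over metatheoretic numbers, lists and formulas.
\<close>

record 'a nat_structure =
  nats :: "'a set" ("\<omega>\<index>")
  zero :: 'a ("\<zero>\<index>")
  suc :: "'a \<Rightarrow> 'a" ("\<S>\<index>")
  add :: "'a \<Rightarrow> 'a \<Rightarrow> 'a" (infixl "\<oplus>\<index>" 65)
  mul :: "'a \<Rightarrow> 'a \<Rightarrow> 'a" (infixl "\<otimes>\<index>" 70)
  exp :: "'a \<Rightarrow> 'a \<Rightarrow> 'a" (infixr "\<up>\<index>" 80)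
  less :: "'a \<Rightarrow> 'a \<Rightarrow> bool" (infix "\<prec>\<index>" 50)

locale arithmetic =
  fixes N :: "'a nat_structure" (structure)
begin

definition le :: "'a \<Rightarrow> 'a \<Rightarrow> bool" (infix "\<preceq>" 50) where
  "x \<preceq> y \<longleftrightarrow> x \<prec> y \<or> x = y"

primrec num :: "nat \<Rightarrow> 'a" where
  "num 0 = \<zero>"
| "num (Suc n) = \<S> (num n)"

definition least :: "('a \<Rightarrow> bool) \<Rightarrow> 'a" where
  "least P = (THE k. k \<in> \<omega> \<and> P k \<and> (\<forall>j\<in>\<omega>. P j \<longrightarrow> k \<preceq> j))"

subsection \<open>Decimal representations\<close>

text \<open>The number of decimal digits (one digit for zero).\<close>
definition len :: "'a \<Rightarrow> 'a" where
  "len x = least (\<lambda>k. num 1 \<preceq> k \<and> x \<prec> num 10 \<up> k)"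

definition append :: "'a \<Rightarrow> 'a \<Rightarrow> 'a" where
  "append x y = x \<otimes> num 10 \<up> len y \<oplus> y"

text \<open>The number written as \<open>k\<close> nines.\<close>
definition nines :: "'a \<Rightarrow> 'a" where
  "nines k = (THE r. r \<in> \<omega> \<and> \<S> r = num 10 \<up> k)"

text \<open>
  The decimal string \<open>9\<dots>90ew\<close> with as many nines as \<open>e\<close> has digits; the block of nines makes
  \<open>e\<close> self-delimiting.
\<close>
definition code :: "'a \<Rightarrow> 'a \<Rightarrow> 'a" where
  "code e w = append (append (nines (len e) \<otimes> num 10) e) w"

subsection \<open>Coded pairs, finite sets and sequences\<close>

text \<open>Injective, because \<open>s\<^sup>2 \<le> s\<^sup>2 + x < (s + 1)\<^sup>2\<close> for \<open>s = x + y\<close>.\<close>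
definition pr :: "'a \<Rightarrow> 'a \<Rightarrow> 'a" where
  "pr x y = (x \<oplus> y) \<otimes> (x \<oplus> y) \<oplus> x"

text \<open>Ackermann membership: bit \<open>u\<close> of \<open>a\<close> is \<open>1\<close>.\<close>
definition bit :: "'a \<Rightarrow> 'a \<Rightarrow> bool" (infix "\<epsilon>" 50) where
  "u \<epsilon> a \<longleftrightarrow> (\<exists>h\<in>\<omega>. \<exists>l\<in>\<omega>. l \<prec> num 2 \<up> u \<and>
     a = h \<otimes> num 2 \<up> \<S> u \<oplus> num 2 \<up> u \<oplus> l)"

definition at :: "'a \<Rightarrow> 'a \<Rightarrow> 'a \<Rightarrow> bool" where
  "at s i c \<longleftrightarrow> pr i c \<epsilon> s"

definition seq :: "'a \<Rightarrow> 'a \<Rightarrow> bool" where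
  "seq s n \<longleftrightarrow> (\<forall>i\<in>\<omega>. i \<preceq> n \<longrightarrow> (\<exists>!c. c \<in> \<omega> \<and> at s i c))"

subsection \<open>Turing machines\<close>

text \<open>
  Two-symbol machines given by finite sets of quintuples: in state \<open>q\<close> reading \<open>a\<close>, print \<open>b\<close>,
  move left (\<open>d = 0\<close>) or right (\<open>d = 1\<close>) and enter state \<open>q'\<close>.
\<close>

definition digits :: "'a set" where
  "digits = {num 0, num 1}"

definition quint :: "'a \<Rightarrow> 'a \<Rightarrow> 'a \<Rightarrow> 'a \<Rightarrow> 'a \<Rightarrow> 'a" where
  "quint q a b d q' = pr q (pr a (pr b (pr d q')))"

definition machine_table :: "'a \<Rightarrow> bool" where
  "machine_table e \<longleftrightarrow> e \<in> \<omega> \<and>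
     (\<forall>u\<in>\<omega>. u \<epsilon> e \<longrightarrow>
        (\<exists>q\<in>\<omega>. \<exists>a\<in>digits. \<exists>b\<in>digits. \<exists>d\<in>digits. \<exists>q'\<in>\<omega>. u = quint q a b d q')) \<and>
     (\<forall>q\<in>\<omega>. \<forall>a\<in>\<omega>. \<forall>x\<in>\<omega>. \<forall>y\<in>\<omega>. pr q (pr a x) \<epsilon> e \<and> pr q (pr a y) \<epsilon> e \<longrightarrow> x = y)"

text \<open>
  A configuration consists of the state \<open>q\<close>, the tape \<open>r\<close> from the head to the right and the tape
  \<open>l\<close> to the left of the head, both read as binary numbers whose lowest bit is nearest to the
  head.
\<close>
definition config :: "'a \<Rightarrow> 'a \<Rightarrow> 'a \<Rightarrow> 'a" where
  "config q l r = pr q (pr l r)"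

definition cons :: "'a \<Rightarrow> 'a \<Rightarrow> 'a" where
  "cons a r = num 2 \<otimes> r \<oplus> a"

definition step :: "'a \<Rightarrow> 'a \<Rightarrow> 'a \<Rightarrow> bool" where
  "step e c c' \<longleftrightarrow>
     (\<exists>q\<in>\<omega>. \<exists>q'\<in>\<omega>. \<exists>a\<in>digits. \<exists>b\<in>digits. \<exists>l\<in>\<omega>. \<exists>r\<in>\<omega>.
        (quint q a b (num 1) q' \<epsilon> e \<and>
           c = config q l (cons a r) \<and> c' = config q' (cons b l) r) \<or>
        (quint q a b (num 0) q' \<epsilon> e \<and>
           (\<exists>z\<in>digits. c = config q (cons z l) (cons a r) \<and>
                       c' = config q' l (cons z (cons b r)))))"

definition halted :: "'a \<Rightarrow> 'a \<Rightarrow> bool" where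
  "halted e c \<longleftrightarrow> \<not> (\<exists>c'\<in>\<omega>. step e c c')"

definition run :: "'a \<Rightarrow> 'a \<Rightarrow> 'a \<Rightarrow> 'a \<Rightarrow> bool" where
  "run e n c c' \<longleftrightarrow> (\<exists>s\<in>\<omega>. seq s n \<and> at s \<zero> c \<and> at s n c' \<and>
     (\<forall>i\<in>\<omega>. \<forall>x\<in>\<omega>. \<forall>y\<in>\<omega>. i \<prec> n \<and> at s i x \<and> at s (\<S> i) y \<longrightarrow> step e x y))"

text \<open>The tape carrying \<open>n + 1\<close> ones, the representation of the number \<open>n\<close>.\<close>
definition strokes :: "'a \<Rightarrow> 'a" where
  "strokes n = (THE t. t \<in> \<omega> \<and> \<S> t = num 2 \<up> \<S> n)"

text \<open>
  The universal coding: \<open>code e w\<close> is the code of the machine that first writes the number \<open>w\<close>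
  and a separating blank in front of the given tape and then operates by the table \<open>e\<close>. In
  \<open>computes c t n x\<close> the machine with code \<open>c\<close>, started on the tape \<open>t\<close>, operates by its table
  for \<open>n\<close> steps and then halts with exactly the number \<open>x\<close> on its tape.
\<close>
definition machine :: "'a \<Rightarrow> bool" where
  "machine c \<longleftrightarrow> (\<exists>e\<in>\<omega>. \<exists>w\<in>\<omega>. machine_table e \<and> c = code e w)"

definition computes :: "'a \<Rightarrow> 'a \<Rightarrow> 'a \<Rightarrow> 'a \<Rightarrow> bool" where
  "computes c t n x \<longleftrightarrow> (\<exists>e\<in>\<omega>. \<exists>w\<in>\<omega>. machine_table e \<and> c = code e w \<and>
     (\<exists>q\<in>\<omega>. run e n (config \<zero> \<zero> (strokes w \<oplus> num 2 \<up> \<S> (\<S> w) \<otimes> t))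
                     (config q \<zero> (strokes x)) \<and>
             halted e (config q \<zero> (strokes x))))"

definition prints :: "'a \<Rightarrow> 'a \<Rightarrow> bool" where
  "prints c x \<longleftrightarrow> (\<exists>n\<in>\<omega>. computes c \<zero> n x)"

definition Kol :: "'a \<Rightarrow> 'a" where
  "Kol x = least (\<lambda>c. prints c x)"

definition accepts_within :: "'a \<Rightarrow> 'a \<Rightarrow> 'a \<Rightarrow> bool" where
  "accepts_within c k x \<longleftrightarrow> (\<exists>n\<in>\<omega>. n \<preceq> k \<and> computes c (strokes x) n (num 1))"

definition accepts :: "'a \<Rightarrow> 'a \<Rightarrow> bool" where
  "accepts c x \<longleftrightarrow> (\<exists>k\<in>\<omega>. accepts_within c k x)"

subsection \<open>Coded formulas\<close>

definition fEq :: "'a \<Rightarrow> 'a \<Rightarrow> 'a" where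
  "fEq i j = pr (num 0) (pr i j)"

definition fRel :: "'a \<Rightarrow> 'a \<Rightarrow> 'a" where
  "fRel r b = pr (num 1) (pr r b)"

definition fNeg :: "'a \<Rightarrow> 'a" where
  "fNeg A = pr (num 2) A"

definition fImp :: "'a \<Rightarrow> 'a \<Rightarrow> 'a" where
  "fImp A B = pr (num 3) (pr A B)"

definition fAll :: "'a \<Rightarrow> 'a \<Rightarrow> 'a" where
  "fAll i A = pr (num 4) (pr i A)"

definition fAnd :: "'a \<Rightarrow> 'a \<Rightarrow> 'a" where
  "fAnd A B = fNeg (fImp A (fNeg B))"

definition fEx :: "'a \<Rightarrow> 'a \<Rightarrow> 'a" where
  "fEx i A = fNeg (fAll i (fNeg A))"

text \<open>An argument list of length \<open>k\<close> is coded as a finite function from \<open>{0..<k}\<close> to variables.\<close>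
definition arg_list :: "'a \<Rightarrow> bool" where
  "arg_list b \<longleftrightarrow> b \<in> \<omega> \<and> (\<exists>k\<in>\<omega>.
     (\<forall>u\<in>\<omega>. u \<epsilon> b \<longrightarrow> (\<exists>i\<in>\<omega>. \<exists>x\<in>\<omega>. i \<prec> k \<and> u = pr i x)) \<and>
     (\<forall>i\<in>\<omega>. i \<prec> k \<longrightarrow> (\<exists>!x. x \<in> \<omega> \<and> pr i x \<epsilon> b)))"

text \<open>
  \<open>a\<close> codes a formula all of whose variables, free or bound, are in \<open>X\<close>. The witness \<open>D\<close> is a
  coded set containing \<open>a\<close> and closed under immediate subformulas; this recursion is well-founded
  because the code of a formula exceeds those of its proper subformulas.
\<close>
definition formula_over :: "'a set \<Rightarrow> 'a \<Rightarrow> bool" where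
  "formula_over X a \<longleftrightarrow> (\<exists>D\<in>\<omega>. a \<epsilon> D \<and> (\<forall>u\<in>\<omega>. u \<epsilon> D \<longrightarrow>
     (\<exists>i\<in>\<omega>. \<exists>j\<in>\<omega>. i \<in> X \<and> j \<in> X \<and> u = fEq i j) \<or>
     (\<exists>r\<in>\<omega>. \<exists>b\<in>\<omega>. arg_list b \<and> (\<forall>i\<in>\<omega>. \<forall>x\<in>\<omega>. pr i x \<epsilon> b \<longrightarrow> x \<in> X) \<and> u = fRel r b) \<or>
     (\<exists>A\<in>\<omega>. A \<epsilon> D \<and> u = fNeg A) \<or>
     (\<exists>A\<in>\<omega>. \<exists>B\<in>\<omega>. A \<epsilon> D \<and> B \<epsilon> D \<and> u = fImp A B) \<or>
     (\<exists>i\<in>\<omega>. \<exists>A\<in>\<omega>. i \<in> X \<and> A \<epsilon> D \<and> u = fAll i A)))"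

definition formula :: "'a \<Rightarrow> bool" where
  "formula a \<longleftrightarrow> a \<in> \<omega> \<and> formula_over \<omega> a"

definition not_in :: "'a \<Rightarrow> 'a \<Rightarrow> bool" where
  "not_in x a \<longleftrightarrow> formula_over (\<omega> - {x}) a"

text \<open>\<open>B\<close> results from the atomic formula \<open>A\<close> by replacing one occurrence of \<open>x\<close> by \<open>y\<close>.\<close>
definition atomic_replace :: "'a \<Rightarrow> 'a \<Rightarrow> 'a \<Rightarrow> 'a \<Rightarrow> bool" where
  "atomic_replace x y A B \<longleftrightarrow>
     (\<exists>z\<in>\<omega>. A = fEq x z \<and> B = fEq y z) \<or>
     (\<exists>z\<in>\<omega>. A = fEq z x \<and> B = fEq z y) \<or>
     (\<exists>r\<in>\<omega>. \<exists>b\<in>\<omega>. \<exists>b'\<in>\<omega>. arg_list b \<and> arg_list b' \<and> A = fRel r b \<and> B = fRel r b' \<and>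
        (\<exists>i\<in>\<omega>. pr i x \<epsilon> b \<and> pr i y \<epsilon> b' \<and>
           (\<forall>j\<in>\<omega>. \<forall>z\<in>\<omega>. j \<noteq> i \<longrightarrow> (pr j z \<epsilon> b \<longleftrightarrow> pr j z \<epsilon> b'))))"

subsection \<open>Proofs\<close>

text \<open>
  Tarski's complete substitution-free axiomatization of predicate logic with equality (1965); the rules are modus ponens and
  generalization. Free variables of nonlogical axioms are thereby read universally.
\<close>
definition logical_axiom :: "'a \<Rightarrow> bool" where
  "logical_axiom a \<longleftrightarrow>
     (\<exists>A\<in>\<omega>. \<exists>B\<in>\<omega>. a = fImp A (fImp B A)) \<or>
     (\<exists>A\<in>\<omega>. \<exists>B\<in>\<omega>. \<exists>C\<in>\<omega>.
        a = fImp (fImp A (fImp B C)) (fImp (fImp A B) (fImp A C))) \<or>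
     (\<exists>A\<in>\<omega>. \<exists>B\<in>\<omega>. a = fImp (fImp (fNeg A) (fNeg B)) (fImp B A)) \<or>
     (\<exists>x\<in>\<omega>. \<exists>A\<in>\<omega>. \<exists>B\<in>\<omega>.
        a = fImp (fAll x (fImp A B)) (fImp (fAll x A) (fAll x B))) \<or>
     (\<exists>x\<in>\<omega>. \<exists>A\<in>\<omega>. a = fImp (fAll x A) A) \<or>
     (\<exists>x\<in>\<omega>. \<exists>A\<in>\<omega>. not_in x A \<and> a = fImp A (fAll x A)) \<or>
     (\<exists>x\<in>\<omega>. \<exists>y\<in>\<omega>. a = fEx x (fEq x y)) \<or>
     (\<exists>x\<in>\<omega>. \<exists>y\<in>\<omega>. \<exists>A\<in>\<omega>. \<exists>B\<in>\<omega>. atomic_replace x y A B \<and>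
        a = fImp (fEq x y) (fImp A B))"

text \<open>\<open>s\<close> is a derivation of \<open>a\<close> from the nonlogical axioms \<open>T\<close>, with lines \<open>0, \<dots>, n\<close>.\<close>
definition derivation :: "'a set \<Rightarrow> 'a \<Rightarrow> 'a \<Rightarrow> 'a \<Rightarrow> bool" where
  "derivation T n s a \<longleftrightarrow> seq s n \<and> at s n a \<and>
     (\<forall>i\<in>\<omega>. \<forall>b\<in>\<omega>. i \<preceq> n \<and> at s i b \<longrightarrow> formula b \<and>
        (logical_axiom b \<or> b \<in> T \<or>
         (\<exists>j\<in>\<omega>. \<exists>k\<in>\<omega>. \<exists>A\<in>\<omega>. j \<prec> i \<and> k \<prec> i \<and> at s j (fImp A b) \<and> at s k A) \<or>
         (\<exists>j\<in>\<omega>. \<exists>x\<in>\<omega>. \<exists>A\<in>\<omega>. j \<prec> i \<and> at s j A \<and> b = fAll x A)))"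

definition provable :: "'a set \<Rightarrow> 'a \<Rightarrow> bool" where
  "provable T a \<longleftrightarrow> (\<exists>n\<in>\<omega>. \<exists>s\<in>\<omega>. derivation T n s a)"

definition consistent :: "'a set \<Rightarrow> bool" where
  "consistent T \<longleftrightarrow> \<not> (\<exists>a\<in>\<omega>. provable T a \<and> provable T (fNeg a))"

definition recognizes :: "'a \<Rightarrow> 'a set \<Rightarrow> bool" where
  "recognizes c T \<longleftrightarrow> c \<in> \<omega> \<and> machine c \<and> T = {a \<in> \<omega>. formula a \<and> accepts c a}"

text \<open>
  \<open>y\<close> is a proof from the theory recognized by \<open>c\<close>. A proof carries a bound \<open>k\<close> on the number of
  steps in which \<open>c\<close> accepts the axioms used, so that being a proof is decidable also when the
  machine \<open>c\<close> does not halt on every input.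
\<close>
definition proof_from :: "'a \<Rightarrow> 'a \<Rightarrow> 'a \<Rightarrow> bool" where
  "proof_from c y a \<longleftrightarrow> (\<exists>n\<in>\<omega>. \<exists>s\<in>\<omega>. \<exists>k\<in>\<omega>. y = pr n (pr s k) \<and>
     derivation {b \<in> \<omega>. accepts_within c k b} n s a)"

subsection \<open>Statements about Kolmogorov complexity\<close>

fun symb_num :: "symb \<Rightarrow> 'a" where
  "symb_num Mem = num 0"
| "symb_num Nat = num 1"
| "symb_num Zero = num 2"
| "symb_num Succ = num 3"
| "symb_num Add = num 4"
| "symb_num Mul = num 5"
| "symb_num Exp = num 6"
| "symb_num (Other n) = num (7 + n)"

fun args :: "nat \<Rightarrow> 'a list \<Rightarrow> 'a" where
  "args i [] = \<zero>"
| "args i (x # xs) = num 2 \<up> pr (num i) x \<oplus> args (Suc i) xs"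

primrec goedel :: "fm \<Rightarrow> 'a" where
  "goedel (Eq i j) = fEq (num i) (num j)"
| "goedel (Rel r is) = fRel (symb_num r) (args 0 (map num is))"
| "goedel (Neg A) = fNeg (goedel A)"
| "goedel (Imp A B) = fImp (goedel A) (goedel B)"
| "goedel (All i A) = fAll (num i) (goedel A)"

text \<open>
  \<open>a\<close> is the formula with the free variable \<open>v\<^bsub>n+2\<^esub>\<close> saying that \<open>v\<^bsub>n+2\<^esub>\<close> is the number \<open>n\<close>:
  \<open>Zero(v\<^bsub>2\<^esub>)\<close> for \<open>n = 0\<close>, and \<open>\<exists>v\<^bsub>i+2\<^esub>. F\<^bsub>i\<^esub> \<and> Succ(v\<^bsub>i+2\<^esub>, v\<^bsub>i+3\<^esub>)\<close> for \<open>n = i + 1\<close>, where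
  \<open>F\<^bsub>i\<^esub>\<close> is the formula for \<open>i\<close>.
\<close>
definition is_number_formula :: "'a \<Rightarrow> 'a \<Rightarrow> bool" where
  "is_number_formula n a \<longleftrightarrow> (\<exists>s\<in>\<omega>. seq s n \<and>
     at s \<zero> (fRel (symb_num Zero) (args 0 [num 2])) \<and> at s n a \<and>
     (\<forall>i\<in>\<omega>. \<forall>b\<in>\<omega>. \<forall>b'\<in>\<omega>. i \<prec> n \<and> at s i b \<and> at s (\<S> i) b' \<longrightarrow>
        b' = fEx (i \<oplus> num 2)
               (fAnd b (fRel (symb_num Succ) (args 0 [i \<oplus> num 2, i \<oplus> num 3])))))"

text \<open>
  \<open>a\<close> is the sentence \<open>\<phi>(L, x)\<close>, that is \<open>\<exists>v\<^bsub>0\<^esub>. v\<^bsub>0\<^esub> = L \<and> (\<exists>v\<^bsub>1\<^esub>. v\<^bsub>1\<^esub> = x \<and> \<phi>(v\<^bsub>0\<^esub>, v\<^bsub>1\<^esub>))\<close>.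
\<close>
definition instance_of :: "fm \<Rightarrow> 'a \<Rightarrow> 'a \<Rightarrow> 'a \<Rightarrow> bool" where
  "instance_of \<phi> L x a \<longleftrightarrow> (\<exists>b\<in>\<omega>. \<exists>b'\<in>\<omega>. is_number_formula L b \<and> is_number_formula x b' \<and>
     a = fEx (num 0) (fAnd (fEx (L \<oplus> num 2) (fAnd b (fEq (L \<oplus> num 2) (num 0))))
          (fEx (num 1) (fAnd (fEx (x \<oplus> num 2) (fAnd b' (fEq (x \<oplus> num 2) (num 1))))
             (goedel \<phi>)))))"

definition proves_instance :: "fm \<Rightarrow> 'a \<Rightarrow> 'a \<Rightarrow> 'a \<Rightarrow> 'a \<Rightarrow> bool" where
  "proves_instance \<phi> c y L x \<longleftrightarrow> (\<exists>a\<in>\<omega>. instance_of \<phi> L x a \<and> proof_from c y a)"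

text \<open>
  The code of the machine that searches for a proof of a statement of the form \<open>L \<le> Kol(x)\<close> from
  the theory recognized by \<open>c\<close>: a fixed concrete table \<open>p\<close> (a number of the metatheory) together
  with \<open>c\<close> and the decimal digits of \<open>L\<close>.
\<close>
definition search_code :: "nat \<Rightarrow> 'a \<Rightarrow> 'a \<Rightarrow> 'a" where
  "search_code p c L = code (num p) (code c L)"

text \<open>
  The table \<open>p\<close> implements the search, where \<open>\<phi>(L, x)\<close> formalizes \<open>L \<le> Kol(x)\<close>: the machine prints
  \<open>x\<close> exactly if the first \<open>y\<close> that is a proof of a statement of this form proves it for \<open>x\<close>.
\<close>
definition implements_search :: "fm \<Rightarrow> nat \<Rightarrow> bool" where
  "implements_search \<phi> p \<longleftrightarrow> machine_table (num p) \<and>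
     (\<forall>c\<in>\<omega>. machine c \<longrightarrow> (\<forall>L\<in>\<omega>. \<forall>x\<in>\<omega>.
        prints (search_code p c L) x \<longleftrightarrow>
        (\<exists>y\<in>\<omega>. proves_instance \<phi> c y L x \<and>
           (\<forall>y'\<in>\<omega>. y' \<prec> y \<longrightarrow> \<not> (\<exists>x'\<in>\<omega>. proves_instance \<phi> c y' L x')))))"

text \<open>
  The constant \<open>C\<close>: the code of the search machine has size \<open>log(L) + C\<close> for every \<open>L\<close>, where sizes
  are numbers of decimal digits.
\<close>
definition search_const :: "nat \<Rightarrow> 'a \<Rightarrow> 'a" where
  "search_const p c =
     (THE C. C \<in> \<omega> \<and> (\<forall>L\<in>\<omega>. len (search_code p c L) = len L \<oplus> C))"

definition \<L> :: "nat \<Rightarrow> 'a \<Rightarrow> 'a" where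
  "\<L> p c = least (\<lambda>L. len L \<oplus> search_const p c \<prec> L)"

end


section \<open>Models of ZF\<close>

record 'a set_structure =
  sets :: "'a set"
  elem :: "'a \<Rightarrow> 'a \<Rightarrow> bool"

locale set_model =
  fixes V :: "'a set_structure" (structure)
begin

abbreviation U :: "'a set" where "U \<equiv> sets V"

definition is_empty :: "'a \<Rightarrow> bool" where
  "is_empty z \<longleftrightarrow> z \<in> U \<and> (\<forall>x\<in>U. \<not> elem V x z)"

definition is_sub :: "'a \<Rightarrow> 'a \<Rightarrow> bool" where
  "is_sub x y \<longleftrightarrow> (\<forall>z\<in>U. elem V z x \<longrightarrow> elem V z y)"

definition is_unordered :: "'a \<Rightarrow> 'a \<Rightarrow> 'a \<Rightarrow> bool" where
  "is_unordered z x y \<longleftrightarrow> z \<in> U \<and> (\<forall>u\<in>U. elem V u z \<longleftrightarrow> u = x \<or> u = y)"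

text \<open>The Kuratowski pair.\<close>
definition is_pair :: "'a \<Rightarrow> 'a \<Rightarrow> 'a \<Rightarrow> bool" where
  "is_pair p x y \<longleftrightarrow> p \<in> U \<and>
     (\<forall>z\<in>U. elem V z p \<longleftrightarrow> is_unordered z x x \<or> is_unordered z x y)"

definition is_succ :: "'a \<Rightarrow> 'a \<Rightarrow> bool" where
  "is_succ x y \<longleftrightarrow> y \<in> U \<and> (\<forall>z\<in>U. elem V z y \<longleftrightarrow> elem V z x \<or> z = x)"

definition is_inductive :: "'a \<Rightarrow> bool" where
  "is_inductive w \<longleftrightarrow> w \<in> U \<and> (\<exists>z. is_empty z \<and> elem V z w) \<and>
     (\<forall>x\<in>U. elem V x w \<longrightarrow> (\<exists>y. is_succ x y \<and> elem V y w))"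

subsection \<open>The natural numbers of a model\<close>

definition omega_set :: 'a where
  "omega_set = (THE w. is_inductive w \<and> (\<forall>z. is_inductive z \<longrightarrow> is_sub w z))"

definition omega_elems :: "'a set" where
  "omega_elems = {n \<in> U. elem V n omega_set}"

definition empty_set :: 'a where
  "empty_set = (THE z. is_empty z)"

definition succ_set :: "'a \<Rightarrow> 'a" where
  "succ_set x = (THE y. is_succ x y)"

definition maps :: "'a \<Rightarrow> 'a \<Rightarrow> 'a \<Rightarrow> bool" where
  "maps g x y \<longleftrightarrow> (\<exists>p. is_pair p x y \<and> elem V p g)"

text \<open>
  The \<open>n\<close>-th value of the function on \<open>\<omega>\<close> (a set of the model) obtained by recursion from \<open>a\<close>
  and \<open>h\<close>.
\<close>
definition recursion :: "'a \<Rightarrow> ('a \<Rightarrow> 'a) \<Rightarrow> 'a \<Rightarrow> 'a" where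
  "recursion a h n = (THE k. k \<in> U \<and> (\<exists>g\<in>U.
     (\<forall>m\<in>omega_elems. \<exists>!y. y \<in> U \<and> maps g m y) \<and>
     maps g empty_set a \<and>
     (\<forall>m\<in>omega_elems. \<forall>y\<in>U. maps g m y \<longrightarrow> maps g (succ_set m) (h y)) \<and>
     maps g n k))"

definition plus :: "'a \<Rightarrow> 'a \<Rightarrow> 'a" where
  "plus m n = recursion m succ_set n"

definition times :: "'a \<Rightarrow> 'a \<Rightarrow> 'a" where
  "times m n = recursion empty_set (\<lambda>x. plus x m) n"

definition power :: "'a \<Rightarrow> 'a \<Rightarrow> 'a" where
  "power m n = recursion (succ_set empty_set) (\<lambda>x. times x m) n"

definition omega :: "'a nat_structure" where
  "omega = \<lparr> nats = omega_elems, zero = empty_set, suc = succ_set,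
             add = plus, mul = times, exp = power, less = elem V \<rparr>"

text \<open>
  The intended meaning of the symbols in the model. Atoms of the wrong arity are false; formulas
  with symbols \<open>Other n\<close>, which have no intended meaning, are never evaluated below.
\<close>
fun interp :: "symb \<Rightarrow> 'a list \<Rightarrow> bool" where
  "interp Mem [x, y] \<longleftrightarrow> elem V x y"
| "interp Nat [x] \<longleftrightarrow> x \<in> omega_elems"
| "interp Zero [x] \<longleftrightarrow> x = empty_set"
| "interp Succ [x, y] \<longleftrightarrow> x \<in> omega_elems \<and> y = succ_set x"
| "interp Add [x, y, z] \<longleftrightarrow> x \<in> omega_elems \<and> y \<in> omega_elems \<and> z = plus x y"
| "interp Mul [x, y, z] \<longleftrightarrow> x \<in> omega_elems \<and> y \<in> omega_elems \<and> z = times x y"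
| "interp Exp [x, y, z] \<longleftrightarrow> x \<in> omega_elems \<and> y \<in> omega_elems \<and> z = power x y"
| "interp _ _ \<longleftrightarrow> False"

abbreviation holds :: "(nat \<Rightarrow> 'a) \<Rightarrow> fm \<Rightarrow> bool" where
  "holds \<equiv> sat U interp"

subsection \<open>The axioms of ZF\<close>

definition extensionality :: bool where
  "extensionality \<longleftrightarrow> (\<forall>x\<in>U. \<forall>y\<in>U. (\<forall>z\<in>U. elem V z x \<longleftrightarrow> elem V z y) \<longrightarrow> x = y)"

definition foundation :: bool where
  "foundation \<longleftrightarrow> (\<forall>x\<in>U. (\<exists>y\<in>U. elem V y x) \<longrightarrow>
     (\<exists>y\<in>U. elem V y x \<and> \<not> (\<exists>z\<in>U. elem V z x \<and> elem V z y)))"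

definition pairing :: bool where
  "pairing \<longleftrightarrow> (\<forall>x\<in>U. \<forall>y\<in>U. \<exists>z. is_unordered z x y)"

definition union :: bool where
  "union \<longleftrightarrow> (\<forall>x\<in>U. \<exists>y\<in>U. \<forall>z\<in>U. elem V z y \<longleftrightarrow> (\<exists>u\<in>U. elem V u x \<and> elem V z u))"

definition powerset :: bool where
  "powerset \<longleftrightarrow> (\<forall>x\<in>U. \<exists>y\<in>U. \<forall>z\<in>U. elem V z y \<longleftrightarrow> is_sub z x)"

definition infinity :: bool where
  "infinity \<longleftrightarrow> (\<exists>w. is_inductive w)"

text \<open>In the schemas, the free variables other than those named are parameters.\<close>
definition separation :: bool where
  "separation \<longleftrightarrow> (\<forall>\<phi> v. symbols \<phi> \<subseteq> {Mem} \<and> range v \<subseteq> U \<longrightarrow>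
     (\<forall>a\<in>U. \<exists>b\<in>U. \<forall>x\<in>U. elem V x b \<longleftrightarrow> elem V x a \<and> holds (v(0 := x)) \<phi>))"

definition replacement :: bool where
  "replacement \<longleftrightarrow> (\<forall>\<phi> v. symbols \<phi> \<subseteq> {Mem} \<and> range v \<subseteq> U \<longrightarrow>
     (\<forall>a\<in>U.
        (\<forall>x\<in>U. elem V x a \<longrightarrow> (\<forall>y\<in>U. \<forall>y'\<in>U.
           holds (v(0 := x, 1 := y)) \<phi> \<and> holds (v(0 := x, 1 := y')) \<phi> \<longrightarrow> y = y')) \<longrightarrow>
        (\<exists>b\<in>U. \<forall>y\<in>U. elem V y b \<longleftrightarrow>
           (\<exists>x\<in>U. elem V x a \<and> holds (v(0 := x, 1 := y)) \<phi>))))"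

definition ZF :: bool where
  "ZF \<longleftrightarrow> extensionality \<and> foundation \<and> pairing \<and> union \<and> powerset \<and> infinity \<and>
     separation \<and> replacement"

text \<open>The formula \<open>\<phi>(v\<^bsub>0\<^esub>, v\<^bsub>1\<^esub>)\<close> expresses \<open>v\<^bsub>0\<^esub> \<le> Kol(v\<^bsub>1\<^esub>)\<close> in the model.\<close>
definition expresses_Kol_bound :: "fm \<Rightarrow> bool" where
  "expresses_Kol_bound \<phi> \<longleftrightarrow> free_vars \<phi> \<subseteq> {0, 1} \<and> symbols \<phi> \<inter> range Other = {} \<and>
     (\<forall>v. range v \<subseteq> U \<longrightarrow> (\<forall>L\<in>omega_elems. \<forall>x\<in>omega_elems.
        holds (v(0 := L, 1 := x)) \<phi> \<longleftrightarrow>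
        arithmetic.le omega L (arithmetic.Kol omega x)))"

end


section \<open>Relations between two models\<close>

abbreviation \<omega>_of :: "'a set_structure \<Rightarrow> 'a nat_structure" where
  "\<omega>_of \<equiv> set_model.omega"

text \<open>\<open>V\<^sub>2\<close> is a set of \<open>V\<^sub>1\<close>.\<close>
definition is_set_of :: "'a set_structure \<Rightarrow> 'a set_structure \<Rightarrow> bool" where
  "is_set_of V\<^sub>2 V\<^sub>1 \<longleftrightarrow>
     sets V\<^sub>2 \<subseteq> sets V\<^sub>1 \<and>
     (\<exists>u\<in>sets V\<^sub>1. \<forall>x\<in>sets V\<^sub>1. elem V\<^sub>1 x u \<longleftrightarrow> x \<in> sets V\<^sub>2) \<and>
     (\<exists>r\<in>sets V\<^sub>1. \<forall>p\<in>sets V\<^sub>1. elem V\<^sub>1 p r \<longleftrightarrow>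
        (\<exists>x\<in>sets V\<^sub>2. \<exists>y\<in>sets V\<^sub>2. elem V\<^sub>2 x y \<and> set_model.is_pair V\<^sub>1 p x y))"

text \<open>\<open>V\<^sub>2\<close> initial-segment number extends \<open>V\<^sub>1\<close> using \<open>f\<close>.\<close>
definition initial_segment_number_extends ::
    "'a set_structure \<Rightarrow> 'a set_structure \<Rightarrow> ('a \<Rightarrow> 'a) \<Rightarrow> bool" where
  "initial_segment_number_extends V\<^sub>2 V\<^sub>1 f \<longleftrightarrow>
     (let N\<^sub>1 = \<omega>_of V\<^sub>1; N\<^sub>2 = \<omega>_of V\<^sub>2 in
       f ` nats N\<^sub>1 \<subseteq> nats N\<^sub>2 \<and>
       f (zero N\<^sub>1) = zero N\<^sub>2 \<and>
       f (suc N\<^sub>1 (zero N\<^sub>1)) = suc N\<^sub>2 (zero N\<^sub>2) \<and>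
       (\<forall>m\<in>nats N\<^sub>1. \<forall>n\<in>nats N\<^sub>1.
          f (add N\<^sub>1 m n) = add N\<^sub>2 (f m) (f n) \<and>
          f (mul N\<^sub>1 m n) = mul N\<^sub>2 (f m) (f n) \<and>
          f (exp N\<^sub>1 m n) = exp N\<^sub>2 (f m) (f n)) \<and>
       (\<forall>b\<in>nats N\<^sub>1. \<forall>a\<in>nats N\<^sub>2. less N\<^sub>2 a (f b) \<longrightarrow> (\<exists>c\<in>nats N\<^sub>1. a = f c)))"

end

theory Submission
  imports Defs
begin

text \<open>
  The code of the search machine is a fixed decimal string followed by the digits of \<open>L\<close>, so the
  constant \<open>C\<close> is an explicit arithmetical expression in the numbers of digits of the table and of
  the code of the theory, and \<open>\<L>\<close> is the least \<open>L\<close> with \<open>log(L) + C < L\<close>. Both are determined by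
  bounded conditions in \<open>+\<close>, \<open>\<cdot>\<close>, exponentiation and \<open><\<close>, which an embedding onto an initial
  segment preserves and reflects. As \<open>\<omega>\<close> may be nonstandard, the arithmetic this needs is
  obtained by induction on properties definable in the model.
\<close>

section \<open>Definability in a model\<close>

text \<open>The obstacle is that \<open>plus\<close>, \<open>times\<close> and \<open>power\<close>
  of a model are definite descriptions over sets of the model. Before any law of arithmetic is
  available, a graph of each must be found inside the model and shown definable, because later
  inductions speak about it. Definability is therefore treated semantically, as a property of
  predicates on assignments that is closed under connectives and quantifiers. It has two levels:
  \<open>definable\<close> for predicates on all sets, where separation applies, and
  \<open>omega_definable\<close> for predicates that matter on numbers only. The locale
  \<open>peano\<close> retains just an abstract class \<open>Def\<close>, so that arithmetic is
  developed once and used in both models.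

  The transfer rests on minima. A solution in the second model below the image of a minimum m would
  itself be an image, by initiality, and its preimage would be a solution below m. This is applied
  first to exponents of ten, giving numbers of digits, and then to the condition defining the bound.
  The minima must exist in the first model; this is where definable induction and the explicit
  solution 10^(C+1) enter.\<close>

lemma finite_free_vars: "finite (free_vars A)"
  by (induction A) auto

lemma sat_cong: "(\<And>i. i \<in> free_vars A \<Longrightarrow> v i = w i) \<Longrightarrow> sat D I v A \<longleftrightarrow> sat D I w A"
proof (induction A arbitrary: v w)
  case (Rel r xs)
  then have "map v xs = map w xs" by simp
  then show ?case by (simp only: sat.simps)
next
  case (Imp A B)
  have "sat D I v A \<longleftrightarrow> sat D I w A" by (rule Imp.IH(1)) (simp add: Imp.prems)
  moreover have "sat D I v B \<longleftrightarrow> sat D I w B" by (rule Imp.IH(2)) (simp add: Imp.prems)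
  ultimately show ?case by simp
next
  case (All i A)
  have "sat D I (v(i := a)) A \<longleftrightarrow> sat D I (w(i := a)) A" for a
    by (rule All.IH) (simp add: All.prems)
  then show ?case by simp
next
  case (Neg A)
  have "sat D I v A \<longleftrightarrow> sat D I w A" by (rule Neg.IH) (simp add: Neg.prems)
  then show ?case by simp
qed simp

text \<open>Since the renaming need not be injective, a bound variable could be captured. The
  quantifier case therefore moves the bound variable to some k outside the image of the free
  variables. This lets definability be proved for one choice of variables and used for every
  other.\<close>

lemma ex_renaming:
  "\<exists>B. symbols B = symbols A \<and> (\<forall>v. sat D I v B \<longleftrightarrow> sat D I (\<lambda>i. v (\<sigma> i)) A)"
proof (induction A arbitrary: \<sigma>)
  case (Eq i j)
  show ?case by (rule exI[of _ "Eq (\<sigma> i) (\<sigma> j)"]) simp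
next
  case (Rel r xs)
  show ?case by (rule exI[of _ "Rel r (map \<sigma> xs)"]) (simp add: comp_def)
next
  case (Neg A)
  then obtain B where "symbols B = symbols A" "\<And>v. sat D I v B \<longleftrightarrow> sat D I (\<lambda>i. v (\<sigma> i)) A"
    by blast
  then show ?case by (intro exI[of _ "Neg B"]) simp
next
  case (Imp A1 A2)
  obtain B1 where B1: "symbols B1 = symbols A1" "\<And>v. sat D I v B1 \<longleftrightarrow> sat D I (\<lambda>i. v (\<sigma> i)) A1"
    using Imp(1) by blast
  obtain B2 where B2: "symbols B2 = symbols A2" "\<And>v. sat D I v B2 \<longleftrightarrow> sat D I (\<lambda>i. v (\<sigma> i)) A2"
    using Imp(2) by blast
  show ?case using B1 B2 by (intro exI[of _ "Imp B1 B2"]) simp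
next
  case (All i A)
  have "finite (\<sigma> ` free_vars A)" by (simp add: finite_free_vars)
  then obtain k where k: "k \<notin> \<sigma> ` free_vars A" using ex_new_if_finite infinite_UNIV_nat by blast
  obtain B where B: "symbols B = symbols A"
      "\<And>v. sat D I v B \<longleftrightarrow> sat D I (\<lambda>j. v ((\<sigma>(i := k)) j)) A"
    using All[of "\<sigma>(i := k)"] by blast
  have "sat D I (\<lambda>j. (v(k := a)) ((\<sigma>(i := k)) j)) A \<longleftrightarrow> sat D I ((\<lambda>j. v (\<sigma> j))(i := a)) A" for v a
    using k by (intro sat_cong) auto
  then show ?case using B by (intro exI[of _ "All k B"]) simp
qed

context set_model
begin

text \<open>A predicate on assignments stands for a formula, so that definability of a concrete
  condition is derived by introduction rules along its syntax. Only \<open>Mem\<close> is allowed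
  because the separation schema has this restriction, and agreement is asked only on assignments
  into the universe because quantifiers range over it.\<close>

definition definable :: "((nat \<Rightarrow> 'a) \<Rightarrow> bool) \<Rightarrow> bool" where
  "definable P \<longleftrightarrow>
     (\<exists>A. symbols A \<subseteq> {Mem} \<and> (\<forall>v. range v \<subseteq> U \<longrightarrow> (holds v A \<longleftrightarrow> P v)))"

section \<open>Closure properties of definable predicates\<close>

lemma definableI:
  "symbols A \<subseteq> {Mem} \<Longrightarrow> (\<And>v. range v \<subseteq> U \<Longrightarrow> holds v A \<longleftrightarrow> P v) \<Longrightarrow> definable P"
  unfolding definable_def by blast

lemma definable_cong:
  "definable Q \<Longrightarrow> (\<And>v. range v \<subseteq> U \<Longrightarrow> P v \<longleftrightarrow> Q v) \<Longrightarrow> definable P"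
  unfolding definable_def by simp

lemma definable_rename:
  assumes "definable P" shows "definable (\<lambda>v. P (\<lambda>i. v (\<sigma> i)))"
proof -
  obtain A where A: "symbols A \<subseteq> {Mem}" "\<And>v. range v \<subseteq> U \<Longrightarrow> holds v A \<longleftrightarrow> P v"
    using assms unfolding definable_def by blast
  obtain B where "symbols B = symbols A" "\<And>v. holds v B \<longleftrightarrow> holds (\<lambda>i. v (\<sigma> i)) A"
    using ex_renaming[of A U interp \<sigma>] by blast
  then show ?thesis using A by (intro definableI[of B]) (auto simp: image_subset_iff)
qed

lemma definable_eq: "definable (\<lambda>v. v i = v j)"
  by (rule definableI[of "Eq i j"]) auto

lemma definable_elem: "definable (\<lambda>v. elem V (v i) (v j))"
  by (rule definableI[of "Rel Mem [i, j]"]) auto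

lemma definable_U: "definable (\<lambda>v. v i \<in> U)"
  \<comment> \<open>For the assignments considered the condition is always true, so a tautology
    defines it.\<close>
  by (rule definable_cong[OF definable_eq[of 0 0]]) auto

lemma definable_not: assumes "definable P" shows "definable (\<lambda>v. \<not> P v)"
proof -
  obtain A where "symbols A \<subseteq> {Mem}" "\<And>v. range v \<subseteq> U \<Longrightarrow> holds v A \<longleftrightarrow> P v"
    using assms unfolding definable_def by blast
  then show ?thesis by (intro definableI[of "Neg A"]) auto
qed

lemma definable_imp:
  assumes "definable P" "definable Q" shows "definable (\<lambda>v. P v \<longrightarrow> Q v)"
proof -
  obtain A where "symbols A \<subseteq> {Mem}" "\<And>v. range v \<subseteq> U \<Longrightarrow> holds v A \<longleftrightarrow> P v"
    using assms unfolding definable_def by blast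
  moreover obtain B where "symbols B \<subseteq> {Mem}" "\<And>v. range v \<subseteq> U \<Longrightarrow> holds v B \<longleftrightarrow> Q v"
    using assms unfolding definable_def by blast
  ultimately show ?thesis by (intro definableI[of "Imp A B"]) auto
qed

text \<open>The quantifier binds variable \<open>0\<close> and shifts the others, so no variable capture can occur.\<close>
lemma definable_all:
  assumes "definable (\<lambda>v. P (\<lambda>i. v (Suc i)) (v 0))"
  shows "definable (\<lambda>v. \<forall>x\<in>U. P v x)"
proof -
  obtain A where A: "symbols A \<subseteq> {Mem}"
      "\<And>v. range v \<subseteq> U \<Longrightarrow> holds v A \<longleftrightarrow> P (\<lambda>i. v (Suc i)) (v 0)"
    using assms unfolding definable_def by blast
  have "definable (\<lambda>v. \<forall>x\<in>U. P (\<lambda>i. v (Suc i)) x)"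
  proof (rule definableI[of "All 0 A"])
    fix v :: "nat \<Rightarrow> 'a" assume v: "range v \<subseteq> U"
    have "holds (v(0 := a)) A \<longleftrightarrow> P (\<lambda>i. v (Suc i)) a" if "a \<in> U" for a
    proof -
      have "range (v(0 := a)) \<subseteq> U" using v that by auto
      then show ?thesis using A(2)[of "v(0 := a)"] by simp
    qed
    then show "holds v (All 0 A) \<longleftrightarrow> (\<forall>x\<in>U. P (\<lambda>i. v (Suc i)) x)" by simp
  qed (use A in simp)
  \<comment> \<open>The predicate just defined reads its assignment from index 1 on; composing with
    the predecessor map moves it back to index 0.\<close>
  from definable_rename[OF this, of "\<lambda>n. n - 1"] show ?thesis by simp
qed

lemma definable_conj:
  assumes "definable P" "definable Q" shows "definable (\<lambda>v. P v \<and> Q v)"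
  using definable_not[OF definable_imp[OF assms(1) definable_not[OF assms(2)]]] by simp

lemma definable_disj:
  assumes "definable P" "definable Q" shows "definable (\<lambda>v. P v \<or> Q v)"
  using definable_imp[OF definable_not[OF assms(1)] assms(2)] by (simp add: disj_imp)

lemma definable_iff:
  assumes "definable P" "definable Q" shows "definable (\<lambda>v. P v \<longleftrightarrow> Q v)"
  using definable_conj[OF definable_imp[OF assms] definable_imp[OF assms(2,1)]]
  by (simp add: iff_conv_conj_imp)

lemma definable_ex:
  assumes "definable (\<lambda>v. P (\<lambda>i. v (Suc i)) (v 0))"
  shows "definable (\<lambda>v. \<exists>x\<in>U. P v x)"
  using definable_not[OF definable_all[of "\<lambda>v x. \<not> P v x", OF definable_not[OF assms]]]
  by simp

lemmas definable_intros = definable_eq definable_elem definable_U definable_not definable_imp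
  definable_conj definable_disj definable_iff definable_all definable_ex

text \<open>The quantifier in \<open>maps\<close> ranges over the whole type, which no formula can
  express; the pair lies in the universe anyway, so the quantifier can be bounded.
  \<open>is_inductive_iff\<close> serves the same purpose.\<close>

lemma maps_iff: "maps g x y \<longleftrightarrow> (\<exists>p\<in>U. is_pair p x y \<and> elem V p g)"
  by (auto simp: maps_def is_pair_def)

lemma is_inductive_iff:
  "is_inductive w \<longleftrightarrow> w \<in> U \<and> (\<exists>z\<in>U. is_empty z \<and> elem V z w) \<and>
     (\<forall>x\<in>U. elem V x w \<longrightarrow> (\<exists>y\<in>U. is_succ x y \<and> elem V y w))"
  unfolding is_inductive_def is_empty_def is_succ_def by blast

section \<open>Definability of the basic set-theoretic notions\<close>

lemma definable_is_empty: "definable (\<lambda>v. is_empty (v i))"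
  unfolding is_empty_def by (intro definable_intros)

lemma definable_is_succ: "definable (\<lambda>v. is_succ (v i) (v j))"
  unfolding is_succ_def by (intro definable_intros)

lemma definable_is_pair: "definable (\<lambda>v. is_pair (v i) (v j) (v k))"
  unfolding is_pair_def is_unordered_def by (intro definable_intros)

lemma definable_maps: "definable (\<lambda>v. maps (v i) (v j) (v k))"
  unfolding maps_iff by (intro definable_intros definable_is_pair)

lemma definable_is_inductive: "definable (\<lambda>v. is_inductive (v i))"
  unfolding is_inductive_iff by (intro definable_intros definable_is_empty definable_is_succ)

lemmas definable_set_intros = definable_intros definable_is_empty
  definable_is_succ definable_is_pair definable_maps definable_is_inductive

end

section \<open>Numbers and recursion in a model of ZF\<close>

locale zf_model = set_model V for V :: "'a set_structure" (structure) +
  assumes ZF: ZF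
begin

lemma set_eqI:
  "x \<in> U \<Longrightarrow> y \<in> U \<Longrightarrow> (\<And>z. z \<in> U \<Longrightarrow> elem V z x \<longleftrightarrow> elem V z y) \<Longrightarrow> x = y"
  using ZF unfolding ZF_def extensionality_def by blast

text \<open>This is separation for predicates instead of formulas: variable 0 is the element tested
  and variables 1 to 4 hold parameters.\<close>

lemma ex_separated:
  assumes "definable (\<lambda>v. P (v 0) (v 1) (v 2) (v 3) (v 4))"
    and "a \<in> U" "b \<in> U" "c \<in> U" "d \<in> U" "e \<in> U"
  obtains s where "s \<in> U" "\<And>x. x \<in> U \<Longrightarrow> elem V x s \<longleftrightarrow> elem V x a \<and> P x b c d e"
proof -
  obtain A where A: "symbols A \<subseteq> {Mem}"
      "\<And>v. range v \<subseteq> U \<Longrightarrow> holds v A \<longleftrightarrow> P (v 0) (v 1) (v 2) (v 3) (v 4)"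
    using assms(1) unfolding definable_def by blast
  \<comment> \<open>The value b serves both for variable 1 and as a filler for all other variables,
    so that the assignment stays in the universe.\<close>
  define v :: "nat \<Rightarrow> 'a" where "v = (\<lambda>_. b)(2 := c, 3 := d, 4 := e)"
  have v: "range v \<subseteq> U" using assms(3-) by (auto simp: v_def)
  have separation using ZF by (simp add: ZF_def)
  from this[unfolded separation_def, rule_format, OF conjI[OF A(1) v] assms(2)]
  obtain s where s: "s \<in> U" "\<And>x. x \<in> U \<Longrightarrow> elem V x s \<longleftrightarrow> elem V x a \<and> holds (v(0 := x)) A"
    by auto
  have "holds (v(0 := x)) A \<longleftrightarrow> P x b c d e" if "x \<in> U" for x
  proof -
    have "range (v(0 := x)) \<subseteq> U" using v that by auto
    then show ?thesis using A(2)[of "v(0 := x)"] by (simp add: v_def)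
  qed
  with s show thesis by (intro that) auto
qed

subsection \<open>Pairs\<close>

lemma ex_unordered:
  assumes "x \<in> U" "y \<in> U" obtains z where "is_unordered z x y"
  using assms ZF unfolding ZF_def pairing_def by blast

lemma is_unordered_unique: "is_unordered z x y \<Longrightarrow> is_unordered z' x y \<Longrightarrow> z = z'"
  unfolding is_unordered_def by (rule set_eqI) auto

lemma ex_pair:
  assumes "x \<in> U" "y \<in> U" obtains p where "p \<in> U" "is_pair p x y"
proof -
  obtain s where s: "is_unordered s x x" using ex_unordered assms by blast
  obtain t where t: "is_unordered t x y" using ex_unordered assms by blast
  have "s \<in> U" "t \<in> U" using s t by (auto simp: is_unordered_def)
  then obtain p where p: "is_unordered p s t" using ex_unordered by blast
  then have "p \<in> U" and p': "\<And>z. z \<in> U \<Longrightarrow> elem V z p \<longleftrightarrow> z = s \<or> z = t"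
    by (auto simp: is_unordered_def)
  have "is_pair p x y"
    unfolding is_pair_def using \<open>p \<in> U\<close> p' s t is_unordered_unique by blast
  with \<open>p \<in> U\<close> show thesis by (rule that)
qed

lemma is_pair_unique: "is_pair p x y \<Longrightarrow> is_pair p' x y \<Longrightarrow> p = p'"
  unfolding is_pair_def by (rule set_eqI) auto

lemma is_pair_inj:
  assumes p: "is_pair p x y" "is_pair p x' y'" and U: "x \<in> U" "y \<in> U" "x' \<in> U" "y' \<in> U"
  shows "x = x' \<and> y = y'"
proof -
  obtain s where s: "is_unordered s x x" using ex_unordered U by blast
  obtain t where t: "is_unordered t x y" using ex_unordered U by blast
  obtain s' where s': "is_unordered s' x' x'" using ex_unordered U by blast
  obtain t' where t': "is_unordered t' x' y'" using ex_unordered U by blast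
  have eq: "z = s \<or> z = t \<longleftrightarrow> z = s' \<or> z = t'" if "z \<in> U" for z
  proof -
    have "elem V z p \<longleftrightarrow> z = s \<or> z = t" using p(1) s t that is_unordered_unique
      unfolding is_pair_def by blast
    moreover have "elem V z p \<longleftrightarrow> z = s' \<or> z = t'" using p(2) s' t' that is_unordered_unique
      unfolding is_pair_def by blast
    ultimately show ?thesis by simp
  qed
  have in_U: "s \<in> U" "t \<in> U" "s' \<in> U" "t' \<in> U" using s t s' t' by (auto simp: is_unordered_def)
  have els: "\<And>u. u \<in> U \<Longrightarrow> elem V u s \<longleftrightarrow> u = x" "\<And>u. u \<in> U \<Longrightarrow> elem V u s' \<longleftrightarrow> u = x'"
      "\<And>u. u \<in> U \<Longrightarrow> elem V u t \<longleftrightarrow> u = x \<or> u = y" "\<And>u. u \<in> U \<Longrightarrow> elem V u t' \<longleftrightarrow> u = x' \<or> u = y'"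
    using s s' t t' unfolding is_unordered_def by auto
  \<comment> \<open>The singleton of x equals one of the two sets with primes, and both contain
    x'.\<close>
  have x: "x = x'" using eq[OF in_U(1)] els(1,2,4) U by metis
  \<comment> \<open>Both directions are used, as either pair may be degenerate, with its two
    components equal.\<close>
  show ?thesis using eq[OF in_U(2)] eq[OF in_U(4)] els U x by metis
qed

lemma maps_iff_elem:
  "is_pair p x y \<Longrightarrow> maps g x y \<longleftrightarrow> elem V p g"
  unfolding maps_def using is_pair_unique by blast

subsection \<open>The natural numbers of the model\<close>

text \<open>Existence comes from infinity, since an inductive set contains an empty set by
  definition; uniqueness is extensionality.\<close>

lemma is_empty_empty_set: "is_empty empty_set"
proof -
  obtain z where z: "is_empty z"
    using ZF unfolding ZF_def infinity_def is_inductive_def by blast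
  show ?thesis unfolding empty_set_def
    by (rule theI[of is_empty, OF z]) (use z in \<open>auto simp: is_empty_def intro: set_eqI\<close>)
qed

text \<open>The successor of x is the union of the unordered pair of x and its singleton s.\<close>

lemma is_succ_succ_set:
  assumes "x \<in> U" shows "is_succ x (succ_set x)"
proof -
  obtain s where s: "is_unordered s x x" using ex_unordered assms by blast
  then have "s \<in> U" by (simp add: is_unordered_def)
  then obtain t where t: "is_unordered t x s" using ex_unordered assms by blast
  then have "t \<in> U" by (simp add: is_unordered_def)
  then obtain y where "y \<in> U" "\<And>z. z \<in> U \<Longrightarrow> elem V z y \<longleftrightarrow> (\<exists>u\<in>U. elem V u t \<and> elem V z u)"
    using ZF unfolding ZF_def union_def by blast
  moreover have "elem V u t \<longleftrightarrow> u = x \<or> u = s" "elem V u s \<longleftrightarrow> u = x" if "u \<in> U" for u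
    using s t that unfolding is_unordered_def by auto
  ultimately have y: "is_succ x y"
    using \<open>s \<in> U\<close> assms unfolding is_succ_def by auto
  show ?thesis unfolding succ_set_def
    by (rule theI[of "is_succ x", OF y]) (use y in \<open>auto simp: is_succ_def intro: set_eqI\<close>)
qed

lemma is_succ_iff: "x \<in> U \<Longrightarrow> is_succ x y \<longleftrightarrow> y = succ_set x"
  using is_succ_succ_set[of x] by (auto simp: is_succ_def intro!: set_eqI)

lemma is_empty_iff: "is_empty x \<longleftrightarrow> x = empty_set"
  using is_empty_empty_set by (auto simp: is_empty_def intro!: set_eqI)

lemma empty_set_in_U [simp]: "empty_set \<in> U"
  using is_empty_empty_set by (simp add: is_empty_def)

lemma succ_set_in_U [simp]: "x \<in> U \<Longrightarrow> succ_set x \<in> U"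
  using is_succ_succ_set by (simp add: is_succ_def)

lemma not_elem_empty_set: "x \<in> U \<Longrightarrow> \<not> elem V x empty_set"
  using is_empty_empty_set by (simp add: is_empty_def)

lemma elem_succ_set: "x \<in> U \<Longrightarrow> z \<in> U \<Longrightarrow> elem V z (succ_set x) \<longleftrightarrow> elem V z x \<or> z = x"
  using is_succ_succ_set by (simp add: is_succ_def)

lemma is_inductive_iff_closed:
  "is_inductive w \<longleftrightarrow> w \<in> U \<and> elem V empty_set w \<and>
     (\<forall>x\<in>U. elem V x w \<longrightarrow> elem V (succ_set x) w)"
  unfolding is_inductive_def by (auto simp: is_empty_iff is_succ_iff)

lemma succ_set_neq_empty_set: "x \<in> U \<Longrightarrow> succ_set x \<noteq> empty_set"
  using elem_succ_set[of x x] not_elem_empty_set[of x] by auto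

text \<open>Otherwise the unordered pair of x and y would have no minimal element, against
  foundation. The case x = y is included and gives irreflexivity.\<close>

lemma elem_asym: assumes "x \<in> U" "y \<in> U" "elem V x y" shows "\<not> elem V y x"
proof
  assume "elem V y x"
  obtain z where z: "is_unordered z x y" using ex_unordered assms by blast
  then have "z \<in> U" and z: "\<And>u. u \<in> U \<Longrightarrow> elem V u z \<longleftrightarrow> u = x \<or> u = y"
    unfolding is_unordered_def by auto
  then have "\<exists>u\<in>U. elem V u z" using assms by blast
  then obtain u where "u \<in> U" "elem V u z" "\<not> (\<exists>t\<in>U. elem V t z \<and> elem V t u)"
    using ZF \<open>z \<in> U\<close> unfolding ZF_def foundation_def by blast
  then show False using z assms \<open>elem V y x\<close> by auto
qed

lemma succ_set_inj:
  assumes "x \<in> U" "y \<in> U" "succ_set x = succ_set y" shows "x = y"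
  using elem_succ_set[of x x] elem_succ_set[of y x] elem_succ_set[of x y] elem_succ_set[of y y]
    elem_asym[of x y] assms by auto

text \<open>The intersection of all inductive sets is separated from one of them, which infinity
  provides. The quantifier over all inductive sets is harmless, as separation admits unbounded
  quantifiers.\<close>

lemma is_inductive_omega_set:
  "is_inductive omega_set \<and> (\<forall>z. is_inductive z \<longrightarrow> is_sub omega_set z)"
proof -
  obtain w where w: "is_inductive w" using ZF unfolding ZF_def infinity_def by blast
  then have "w \<in> U" by (simp add: is_inductive_def)
  have D: "definable (\<lambda>v. \<forall>z\<in>U. is_inductive z \<longrightarrow> elem V (v 0) z)"
    by (intro definable_set_intros)
  obtain s where s: "s \<in> U"
      "\<And>x. x \<in> U \<Longrightarrow> elem V x s \<longleftrightarrow> elem V x w \<and> (\<forall>z\<in>U. is_inductive z \<longrightarrow> elem V x z)"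
    by (rule ex_separated[of "\<lambda>x _ _ _ _. \<forall>z\<in>U. is_inductive z \<longrightarrow> elem V x z" w w w w w,
          OF D \<open>w \<in> U\<close> \<open>w \<in> U\<close> \<open>w \<in> U\<close> \<open>w \<in> U\<close> \<open>w \<in> U\<close>]) blast
  have "is_inductive s"
    unfolding is_inductive_iff_closed using s w by (auto simp: is_inductive_iff_closed)
  moreover have sub: "is_sub s z" if "is_inductive z" for z
    using that s unfolding is_sub_def by (auto simp: is_inductive_iff_closed)
  ultimately have *: "is_inductive s \<and> (\<forall>z. is_inductive z \<longrightarrow> is_sub s z)" by blast
  show ?thesis unfolding omega_set_def
  proof (rule theI[of "\<lambda>s. is_inductive s \<and> (\<forall>z. is_inductive z \<longrightarrow> is_sub s z)", OF *])
    fix t assume "is_inductive t \<and> (\<forall>z. is_inductive z \<longrightarrow> is_sub t z)"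
    then have "t \<in> U" "is_sub t s" "is_sub s t" using * unfolding is_inductive_def by blast+
    then show "t = s" using \<open>s \<in> U\<close> unfolding is_sub_def by (intro set_eqI) blast+
  qed
qed

lemma omega_set_in_U [simp]: "omega_set \<in> U"
  using is_inductive_omega_set by (simp add: is_inductive_def)

lemma omega_elems_in_U: "n \<in> omega_elems \<Longrightarrow> n \<in> U"
  by (simp add: omega_elems_def)

lemma elem_omega_set: "x \<in> U \<Longrightarrow> elem V x omega_set \<longleftrightarrow> x \<in> omega_elems"
  by (simp add: omega_elems_def)

lemma empty_set_in_omega [simp]: "empty_set \<in> omega_elems"
  using is_inductive_omega_set by (simp add: omega_elems_def is_inductive_iff_closed)

lemma succ_set_in_omega [simp]: "n \<in> omega_elems \<Longrightarrow> succ_set n \<in> omega_elems"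
  using is_inductive_omega_set by (simp add: omega_elems_def is_inductive_iff_closed)

text \<open>A definable hereditary property cuts an inductive set out of omega, and omega is the
  least such set. Without definability this fails in a nonstandard model, where being a standard
  number is hereditary.\<close>

lemma omega_induct:
  assumes "definable (\<lambda>v. P (v 0) (v 1) (v 2) (v 3) (v 4))"
    and "b \<in> U" "c \<in> U" "d \<in> U" "e \<in> U"
    and "P empty_set b c d e"
    and "\<And>n. n \<in> omega_elems \<Longrightarrow> P n b c d e \<Longrightarrow> P (succ_set n) b c d e"
    and "n \<in> omega_elems"
  shows "P n b c d e"
proof -
  obtain s where s: "s \<in> U" "\<And>x. x \<in> U \<Longrightarrow> elem V x s \<longleftrightarrow> elem V x omega_set \<and> P x b c d e"
    by (rule ex_separated[of P, OF assms(1) omega_set_in_U assms(2-5)]) blast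
  have elem_s: "elem V x s \<longleftrightarrow> x \<in> omega_elems \<and> P x b c d e" if "x \<in> U" for x
    using s(2)[OF that] elem_omega_set[OF that] by blast
  have "is_inductive s"
    unfolding is_inductive_iff_closed using s(1) assms(6,7) elem_s
    by (metis empty_set_in_U empty_set_in_omega succ_set_in_U succ_set_in_omega)
  then have "is_sub omega_set s" using is_inductive_omega_set by blast
  then have "elem V n s" using assms(8) unfolding is_sub_def omega_elems_def by blast
  then show ?thesis using elem_s[OF omega_elems_in_U[OF assms(8)]] by blast
qed

text \<open>Belonging to every inductive set is a condition without parameters, whereas membership
  in \<open>omega_set\<close> would occupy one.\<close>

lemma definable_elem_omega: "definable (\<lambda>v. v i \<in> omega_elems)"
proof -
  have "definable (\<lambda>v. \<forall>w\<in>U. is_inductive w \<longrightarrow> elem V (v i) w)"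
    by (intro definable_set_intros)
  moreover have "v i \<in> omega_elems \<longleftrightarrow> (\<forall>w\<in>U. is_inductive w \<longrightarrow> elem V (v i) w)"
    if "range v \<subseteq> U" for v
  proof -
    have "v i \<in> U" using that by auto
    then show ?thesis using is_inductive_omega_set omega_set_in_U
      unfolding is_sub_def omega_elems_def by blast
  qed
  ultimately show ?thesis by (rule definable_cong)
qed

subsection \<open>Recursion\<close>

text \<open>A Kuratowski pair of numbers is a set of subsets of omega, so the product can be
  separated from the double power set of omega.\<close>

lemma ex_omega_product:
  obtains q where "q \<in> U"
    "\<And>p. p \<in> U \<Longrightarrow> elem V p q \<longleftrightarrow> (\<exists>x\<in>omega_elems. \<exists>y\<in>omega_elems. is_pair p x y)"
proof -
  obtain P where P: "P \<in> U" "\<And>z. z \<in> U \<Longrightarrow> elem V z P \<longleftrightarrow> is_sub z omega_set"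
    using ZF omega_set_in_U unfolding ZF_def powerset_def by blast
  obtain PP where PP: "PP \<in> U" "\<And>z. z \<in> U \<Longrightarrow> elem V z PP \<longleftrightarrow> is_sub z P"
    using ZF P(1) unfolding ZF_def powerset_def by blast
  have D: "definable (\<lambda>v. \<exists>x\<in>U. \<exists>y\<in>U. elem V x (v 1) \<and> elem V y (v 1) \<and> is_pair (v 0) x y)"
    by (intro definable_set_intros)
  obtain q where q: "q \<in> U" "\<And>p. p \<in> U \<Longrightarrow> elem V p q \<longleftrightarrow> elem V p PP \<and>
        (\<exists>x\<in>U. \<exists>y\<in>U. elem V x omega_set \<and> elem V y omega_set \<and> is_pair p x y)"
    by (rule ex_separated[of "\<lambda>p w _ _ _. \<exists>x\<in>U. \<exists>y\<in>U. elem V x w \<and> elem V y w \<and> is_pair p x y",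
          OF D PP(1) omega_set_in_U omega_set_in_U omega_set_in_U omega_set_in_U]) blast
  have "elem V p PP" if p: "p \<in> U" "is_pair p x y" "x \<in> omega_elems" "y \<in> omega_elems" for p x y
  proof -
    have "is_sub z omega_set" if "z \<in> U" "elem V z p" for z
      using p that unfolding is_pair_def is_unordered_def is_sub_def omega_elems_def by auto
    then have "is_sub p P" using P(2) unfolding is_sub_def[of p] by blast
    then show ?thesis using p(1) PP(2) by blast
  qed
  then have "elem V p q \<longleftrightarrow> (\<exists>x\<in>omega_elems. \<exists>y\<in>omega_elems. is_pair p x y)" if "p \<in> U" for p
    using q(2)[OF that] that unfolding omega_elems_def by blast
  with q(1) show thesis by (rule that)
qed

lemma ex_maps_separated:
  assumes "definable (\<lambda>v. P (v 0) (v 1) (v 2) (v 3) (v 4))"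
    and "b \<in> U" "c \<in> U" "d \<in> U"
  obtains g where "g \<in> U" "\<And>x y. x \<in> U \<Longrightarrow> y \<in> U \<Longrightarrow>
      maps g x y \<longleftrightarrow> x \<in> omega_elems \<and> y \<in> omega_elems \<and> P x y b c d"
proof -
  obtain q where q: "q \<in> U"
      "\<And>p. p \<in> U \<Longrightarrow> elem V p q \<longleftrightarrow> (\<exists>x\<in>omega_elems. \<exists>y\<in>omega_elems. is_pair p x y)"
    using ex_omega_product by metis
  \<comment> \<open>Under the two quantifiers below, y is variable 0, x is variable 1 and the pair
    is variable 2. Hence x and y are swapped and the parameters move up by one.\<close>
  define \<sigma> :: "nat \<Rightarrow> nat" where "\<sigma> i = (if i = 0 then 1 else if i = 1 then 0 else i + 1)" for i
  have "definable (\<lambda>v. P (v (Suc 0)) (v 0) (v 3) (v 4) (v 5))"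
    using definable_rename[OF assms(1), of \<sigma>] by (simp add: \<sigma>_def numeral_eq_Suc)
  then have D: "definable (\<lambda>v. \<exists>x\<in>U. \<exists>y\<in>U. is_pair (v 0) x y \<and> P x y (v 1) (v 2) (v 3))"
    by (intro definable_set_intros) (simp add: numeral_eq_Suc)
  obtain g where g: "g \<in> U" "\<And>p. p \<in> U \<Longrightarrow> elem V p g \<longleftrightarrow> elem V p q \<and>
        (\<exists>x\<in>U. \<exists>y\<in>U. is_pair p x y \<and> P x y b c d)"
    by (rule ex_separated[of "\<lambda>p b c d _. \<exists>x\<in>U. \<exists>y\<in>U. is_pair p x y \<and> P x y b c d",
          OF D q(1) assms(2-4) assms(4)]) blast
  have "maps g x y \<longleftrightarrow> x \<in> omega_elems \<and> y \<in> omega_elems \<and> P x y b c d"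
    if xy: "x \<in> U" "y \<in> U" for x y
  proof -
    obtain p where p: "p \<in> U" "is_pair p x y" by (rule ex_pair[OF xy])
    have "x' = x \<and> y' = y" if "x' \<in> U" "y' \<in> U" "is_pair p x' y'" for x' y'
      using is_pair_inj[OF p(2) that(3)] xy that by auto
    then show ?thesis unfolding maps_iff_elem[OF p(2)] g(2)[OF p(1)] q(2)[OF p(1)]
      using p xy omega_elems_in_U by metis
  qed
  with g(1) show thesis by (rule that)
qed

section \<open>Relations closed under a recursion\<close>

definition total_map :: "'a \<Rightarrow> bool" where
  "total_map g \<longleftrightarrow> (\<forall>m\<in>omega_elems. \<exists>!y. y \<in> U \<and> maps g m y)"

text \<open>The values y are restricted to numbers, because nothing is known about h elsewhere. The
  clause in \<open>recursion\<close> ranges over the whole universe; for a relation with values in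
  omega the two agree.\<close>

definition recursion_closed :: "'a \<Rightarrow> ('a \<Rightarrow> 'a) \<Rightarrow> 'a \<Rightarrow> bool" where
  "recursion_closed a h g \<longleftrightarrow> maps g empty_set a \<and>
     (\<forall>x\<in>omega_elems. \<forall>y\<in>omega_elems. maps g x y \<longrightarrow> maps g (succ_set x) (h y))"

lemma total_map_unique:
  "total_map g \<Longrightarrow> m \<in> omega_elems \<Longrightarrow> x \<in> U \<Longrightarrow> y \<in> U \<Longrightarrow> maps g m x \<Longrightarrow> maps g m y \<Longrightarrow> x = y"
  unfolding total_map_def by blast

text \<open>A common value at n leads to a common value at the successor, namely its image under h.
  The induction predicate mentions only the two relations, so h need not be definable. Taking both
  relations equal shows that a closed relation has a value in omega at every number.\<close>

lemma recursion_closed_agree: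
  assumes g: "recursion_closed a h g" "g \<in> U" and g': "recursion_closed a h g'" "g' \<in> U"
    and a: "a \<in> omega_elems" and h: "\<And>y. y \<in> omega_elems \<Longrightarrow> h y \<in> omega_elems"
    and n: "n \<in> omega_elems"
  shows "\<exists>y\<in>U. y \<in> omega_elems \<and> maps g n y \<and> maps g' n y"
proof -
  have D: "definable (\<lambda>v. \<exists>y\<in>U. y \<in> omega_elems \<and> maps (v 1) (v 0) y \<and> maps (v 2) (v 0) y)"
    by (intro definable_set_intros definable_elem_omega)
  show ?thesis
  proof (rule omega_induct[of "\<lambda>n g g' _ _. \<exists>y\<in>U. y \<in> omega_elems \<and> maps g n y \<and> maps g' n y",
        OF D g(2) g'(2) g(2) g(2) _ _ n])
    show "\<exists>y\<in>U. y \<in> omega_elems \<and> maps g empty_set y \<and> maps g' empty_set y"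
      using g(1) g'(1) a omega_elems_in_U unfolding recursion_closed_def by blast
  next
    fix n assume n: "n \<in> omega_elems" and "\<exists>y\<in>U. y \<in> omega_elems \<and> maps g n y \<and> maps g' n y"
    then obtain y where "y \<in> omega_elems" "maps g n y" "maps g' n y" by blast
    then show "\<exists>y\<in>U. y \<in> omega_elems \<and> maps g (succ_set n) y \<and> maps g' (succ_set n) y"
      using g(1) g'(1) n h omega_elems_in_U unfolding recursion_closed_def by blast
  qed
qed

lemma definable_ternary:
  assumes "definable (\<lambda>v. R (v 0) (v 1) (v 2))" shows "definable (\<lambda>v. R (v i) (v j) (v k))"
  using definable_rename[OF assms, of "\<lambda>n. if n = 0 then i else if n = 1 then j else k"] by simp

text \<open>This is \<open>recursion_closed\<close> with h replaced by its graph R with parameter c: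
  h is a function of the metatheory, and closedness must become a formula before sets can be
  separated by it.\<close>

definition recursion_rel_closed :: "('a \<Rightarrow> 'a \<Rightarrow> 'a \<Rightarrow> bool) \<Rightarrow> 'a \<Rightarrow> 'a \<Rightarrow> 'a \<Rightarrow> bool" where
  "recursion_rel_closed R r a c \<longleftrightarrow> (\<exists>e\<in>U. is_empty e \<and> maps r e a) \<and>
     (\<forall>x\<in>U. \<forall>y\<in>U. \<forall>x'\<in>U. \<forall>z\<in>U. x \<in> omega_elems \<and> y \<in> omega_elems \<and> z \<in> omega_elems \<and>
        is_succ x x' \<and> R y z c \<and> maps r x y \<longrightarrow> maps r x' z)"

lemma definable_recursion_rel_closed:
  assumes R: "definable (\<lambda>v. R (v 0) (v 1) (v 2))"
  shows "definable (\<lambda>v. recursion_rel_closed R (v i) (v j) (v k))"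
  unfolding recursion_rel_closed_def
  by (intro definable_set_intros definable_elem_omega definable_ternary[of R, OF R])

lemma recursion_rel_closed_iff:
  assumes Rh: "\<And>y z. y \<in> omega_elems \<Longrightarrow> z \<in> omega_elems \<Longrightarrow> R y z c \<longleftrightarrow> z = h y"
    and h: "\<And>y. y \<in> omega_elems \<Longrightarrow> h y \<in> omega_elems"
  shows "recursion_rel_closed R r a c \<longleftrightarrow> recursion_closed a h r"
proof -
  have "(\<exists>e\<in>U. is_empty e \<and> maps r e a) \<longleftrightarrow> maps r empty_set a"
    by (simp add: is_empty_iff)
  moreover have "(\<forall>x\<in>U. \<forall>y\<in>U. \<forall>x'\<in>U. \<forall>z\<in>U. x \<in> omega_elems \<and> y \<in> omega_elems \<and>
        z \<in> omega_elems \<and> is_succ x x' \<and> R y z c \<and> maps r x y \<longrightarrow> maps r x' z) \<longleftrightarrow>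
      (\<forall>x\<in>omega_elems. \<forall>y\<in>omega_elems. maps r x y \<longrightarrow> maps r (succ_set x) (h y))"
    (is "?l \<longleftrightarrow> ?r")
  proof
    assume ?l
    show ?r
    proof (intro ballI impI)
      fix x y assume xy: "x \<in> omega_elems" "y \<in> omega_elems" "maps r x y"
      then have "x \<in> U" "y \<in> U" "succ_set x \<in> U" "h y \<in> U" "is_succ x (succ_set x)" "R y (h y) c"
        using omega_elems_in_U h is_succ_succ_set Rh by auto
      then show "maps r (succ_set x) (h y)" using \<open>?l\<close> xy h by blast
    qed
  next
    assume ?r
    show ?l
    proof (intro ballI impI)
      fix x y x' z
      assume "x \<in> U" and *: "x \<in> omega_elems \<and> y \<in> omega_elems \<and> z \<in> omega_elems \<and>
        is_succ x x' \<and> R y z c \<and> maps r x y"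
      then have "x' = succ_set x" "z = h y" using is_succ_iff[of x x'] Rh[of y z] by blast+
      then show "maps r x' z" using \<open>?r\<close> * by blast
    qed
  qed
  ultimately show ?thesis unfolding recursion_rel_closed_def recursion_closed_def by blast
qed

text \<open>
  The graph is the intersection of all sets closed under the recursion; a second value at a point
  could be removed from it.
\<close>
lemma ex_recursion_graph:
  assumes R: "definable (\<lambda>v. R (v 0) (v 1) (v 2))"
    and Rh: "\<And>y z. y \<in> omega_elems \<Longrightarrow> z \<in> omega_elems \<Longrightarrow> R y z c \<longleftrightarrow> z = h y"
    and a: "a \<in> omega_elems" and c: "c \<in> omega_elems"
    and h: "\<And>y. y \<in> omega_elems \<Longrightarrow> h y \<in> omega_elems"
  obtains g where "g \<in> U" "total_map g" "recursion_closed a h g"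
    "\<And>x y. x \<in> U \<Longrightarrow> y \<in> U \<Longrightarrow> maps g x y \<Longrightarrow> y \<in> omega_elems"
proof -
  have cl: "recursion_rel_closed R r a c \<longleftrightarrow> recursion_closed a h r" for r
    using Rh h by (rule recursion_rel_closed_iff)
  have D: "definable (\<lambda>v. \<forall>r\<in>U. recursion_rel_closed R r (v 2) (v 3) \<longrightarrow> maps r (v 0) (v 1))"
    by (intro definable_intros definable_maps definable_recursion_rel_closed R)
  obtain g where "g \<in> U" and g: "\<And>x y. x \<in> U \<Longrightarrow> y \<in> U \<Longrightarrow> maps g x y \<longleftrightarrow>
      x \<in> omega_elems \<and> y \<in> omega_elems \<and> (\<forall>r\<in>U. recursion_rel_closed R r a c \<longrightarrow> maps r x y)"
    by (rule ex_maps_separated[of "\<lambda>x y a c _. \<forall>r\<in>U. recursion_rel_closed R r a c \<longrightarrow> maps r x y",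
          OF D omega_elems_in_U[OF a] omega_elems_in_U[OF c] omega_elems_in_U[OF c]]) blast
  have g_closed: "recursion_closed a h g"
    unfolding recursion_closed_def
  proof (intro conjI ballI impI)
    show "maps g empty_set a"
      using g[OF empty_set_in_U omega_elems_in_U[OF a]] a empty_set_in_omega
      unfolding cl recursion_closed_def by blast
  next
    fix x y assume xy: "x \<in> omega_elems" "y \<in> omega_elems" "maps g x y"
    then have "maps r x y" if "r \<in> U" "recursion_closed a h r" for r
      using g[of x y] that omega_elems_in_U unfolding cl by blast
    then have "maps r (succ_set x) (h y)" if "r \<in> U" "recursion_closed a h r" for r
      using that xy unfolding recursion_closed_def by blast
    then show "maps g (succ_set x) (h y)"
      using g[of "succ_set x" "h y"] xy h omega_elems_in_U succ_set_in_omega unfolding cl by blast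
  qed
  have removable: "\<not> recursion_closed a h r"
    if "maps g x y" "x \<in> U" "y \<in> U" "r \<in> U" "\<not> maps r x y" for x y r
    using g[of x y] that unfolding cl by blast
  \<comment> \<open>Minimality of g only concerns relations that are sets of the model, so deleting
    one pair has to be done by separation.\<close>
  have remove: "\<exists>r\<in>U. \<forall>x'\<in>U. \<forall>y'\<in>U. maps r x' y' \<longleftrightarrow> maps g x' y' \<and> \<not> (x' = x \<and> y' = y)"
    if xy: "x \<in> U" "y \<in> U" for x y
  proof -
    have D: "definable (\<lambda>v. maps (v 2) (v 0) (v 1) \<and> \<not> (v 0 = v 3 \<and> v 1 = v 4))"
      by (intro definable_set_intros)
    obtain r where "r \<in> U" "\<And>x' y'. x' \<in> U \<Longrightarrow> y' \<in> U \<Longrightarrow> maps r x' y' \<longleftrightarrow>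
        x' \<in> omega_elems \<and> y' \<in> omega_elems \<and> maps g x' y' \<and> \<not> (x' = x \<and> y' = y)"
      by (rule ex_maps_separated[of "\<lambda>x' y' g x y. maps g x' y' \<and> \<not> (x' = x \<and> y' = y)",
          OF D \<open>g \<in> U\<close> xy]) blast
    then show ?thesis using g by blast
  qed
  have DE: "definable (\<lambda>v. \<exists>y\<in>U. maps (v 1) (v 0) y \<and> (\<forall>z\<in>U. maps (v 1) (v 0) z \<longrightarrow> z = y))"
    by (intro definable_set_intros)
  have total: "\<exists>y\<in>U. maps g m y \<and> (\<forall>z\<in>U. maps g m z \<longrightarrow> z = y)" if "m \<in> omega_elems" for m
  proof (rule omega_induct[of
        "\<lambda>m g _ _ _. \<exists>y\<in>U. maps g m y \<and> (\<forall>z\<in>U. maps g m z \<longrightarrow> z = y)",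
        OF DE \<open>g \<in> U\<close> \<open>g \<in> U\<close> \<open>g \<in> U\<close> \<open>g \<in> U\<close> _ _ that])
    have "b = a" if b: "b \<in> U" "maps g empty_set b" for b
    proof (rule ccontr)
      assume "b \<noteq> a"
      obtain r where "r \<in> U" and r: "\<And>x' y'. x' \<in> U \<Longrightarrow> y' \<in> U \<Longrightarrow>
          maps r x' y' \<longleftrightarrow> maps g x' y' \<and> \<not> (x' = empty_set \<and> y' = b)"
        using remove[OF empty_set_in_U b(1)] by blast
      have "recursion_closed a h r"
        unfolding recursion_closed_def
      proof (intro conjI ballI impI)
        show "maps r empty_set a"
          using r[OF empty_set_in_U omega_elems_in_U[OF a]] \<open>b \<noteq> a\<close> g_closed
          unfolding recursion_closed_def by blast
      next
        fix x y assume xy: "x \<in> omega_elems" "y \<in> omega_elems" "maps r x y"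
        then have U: "x \<in> U" "y \<in> U" "succ_set x \<in> U" "h y \<in> U"
          using omega_elems_in_U h by auto
        have "maps g (succ_set x) (h y)"
          using r[OF U(1,2)] xy g_closed unfolding recursion_closed_def by blast
        \<comment> \<open>The deleted pair sits at the empty set, which is not a successor, so the
          recursion step never produces it.\<close>
        then show "maps r (succ_set x) (h y)"
          using r[OF U(3,4)] succ_set_neq_empty_set[OF U(1)] by blast
      qed
      then show False using removable[OF b(2) empty_set_in_U b(1) \<open>r \<in> U\<close>]
          r[OF empty_set_in_U b(1)] by blast
    qed
    then show "\<exists>y\<in>U. maps g empty_set y \<and> (\<forall>z\<in>U. maps g empty_set z \<longrightarrow> z = y)"
      using g_closed omega_elems_in_U[OF a] unfolding recursion_closed_def by blast
  next
    fix m assume m: "m \<in> omega_elems"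
      and "\<exists>y\<in>U. maps g m y \<and> (\<forall>z\<in>U. maps g m z \<longrightarrow> z = y)"
    then obtain y where y: "y \<in> U" "maps g m y" "\<And>z. z \<in> U \<Longrightarrow> maps g m z \<Longrightarrow> z = y" by blast
    have mU: "m \<in> U" "succ_set m \<in> U" using omega_elems_in_U[OF m] by auto
    have y_omega: "y \<in> omega_elems" using g[OF mU(1) y(1)] y(2) by blast
    have step: "maps g (succ_set m) (h y)"
      using g_closed m y_omega y(2) unfolding recursion_closed_def by blast
    have "b = h y" if b: "b \<in> U" "maps g (succ_set m) b" for b
    proof (rule ccontr)
      assume "b \<noteq> h y"
      obtain r where "r \<in> U" and r: "\<And>x' y'. x' \<in> U \<Longrightarrow> y' \<in> U \<Longrightarrow>
          maps r x' y' \<longleftrightarrow> maps g x' y' \<and> \<not> (x' = succ_set m \<and> y' = b)"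
        using remove[OF mU(2) b(1)] by blast
      have "recursion_closed a h r"
        unfolding recursion_closed_def
      proof (intro conjI ballI impI)
        show "maps r empty_set a"
          using r[OF empty_set_in_U omega_elems_in_U[OF a]] succ_set_neq_empty_set[OF mU(1)] g_closed
          unfolding recursion_closed_def by metis
      next
        fix x z assume xz: "x \<in> omega_elems" "z \<in> omega_elems" "maps r x z"
        then have U: "x \<in> U" "z \<in> U" "succ_set x \<in> U" "h z \<in> U"
          using omega_elems_in_U h by auto
        have xz': "maps g x z" using r[OF U(1,2)] xz by blast
        then have "maps g (succ_set x) (h z)"
          using xz g_closed unfolding recursion_closed_def by blast
        \<comment> \<open>If the step produced the deleted pair, then x would be m, so z would be
          the unique value y at m, and b would be \<open>h y\<close>.\<close>
        moreover have "\<not> (succ_set x = succ_set m \<and> h z = b)"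
          using succ_set_inj[OF U(1) mU(1)] y(3)[OF U(2)] xz' \<open>b \<noteq> h y\<close> by metis
        ultimately show "maps r (succ_set x) (h z)" using r[OF U(3,4)] by blast
      qed
      then show False using removable[OF b(2) mU(2) b(1) \<open>r \<in> U\<close>] r[OF mU(2) b(1)] by blast
    qed
    then show "\<exists>y\<in>U. maps g (succ_set m) y \<and> (\<forall>z\<in>U. maps g (succ_set m) z \<longrightarrow> z = y)"
      using step omega_elems_in_U[OF h[OF y_omega]] by blast
  qed
  show thesis
  proof (rule that[OF \<open>g \<in> U\<close> _ g_closed])
    show "total_map g" unfolding total_map_def using total by blast
    show "y \<in> omega_elems" if "x \<in> U" "y \<in> U" "maps g x y" for x y
      using g[of x y] that by blast
  qed
qed

text \<open>The description in \<open>recursion\<close> refers to some graph, not to a fixed one. It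
  is still unique, since any two graphs share a value at n and each is single-valued there.\<close>

lemma recursion_graph:
  assumes g: "g \<in> U" "total_map g" "recursion_closed a h g"
      "\<And>x y. x \<in> U \<Longrightarrow> y \<in> U \<Longrightarrow> maps g x y \<Longrightarrow> y \<in> omega_elems"
    and a: "a \<in> omega_elems" and h: "\<And>y. y \<in> omega_elems \<Longrightarrow> h y \<in> omega_elems"
    and n: "n \<in> omega_elems"
  shows "recursion a h n \<in> omega_elems" "maps g n (recursion a h n)"
proof -
  obtain y where y: "y \<in> U" "y \<in> omega_elems" "maps g n y"
    using recursion_closed_agree[OF g(3,1) g(3,1) a h n] by blast
  have "recursion a h n = y"
    unfolding recursion_def
  proof (rule the_equality)
    show "y \<in> U \<and> (\<exists>g\<in>U. (\<forall>m\<in>omega_elems. \<exists>!y. y \<in> U \<and> maps g m y) \<and> maps g empty_set a \<and>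
        (\<forall>m\<in>omega_elems. \<forall>y\<in>U. maps g m y \<longrightarrow> maps g (succ_set m) (h y)) \<and> maps g n y)"
    proof (intro conjI bexI[of _ g] y(1,3) g(1))
      show "\<forall>m\<in>omega_elems. \<exists>!y. y \<in> U \<and> maps g m y" using g(2) unfolding total_map_def .
      show "maps g empty_set a" using g(3) unfolding recursion_closed_def by blast
      show "\<forall>m\<in>omega_elems. \<forall>y\<in>U. maps g m y \<longrightarrow> maps g (succ_set m) (h y)"
        using g(3,4) omega_elems_in_U unfolding recursion_closed_def by blast
    qed
  next
    fix k assume "k \<in> U \<and> (\<exists>g\<in>U. (\<forall>m\<in>omega_elems. \<exists>!y. y \<in> U \<and> maps g m y) \<and> maps g empty_set a \<and>
        (\<forall>m\<in>omega_elems. \<forall>y\<in>U. maps g m y \<longrightarrow> maps g (succ_set m) (h y)) \<and> maps g n k)"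
    then obtain g' where "k \<in> U" "g' \<in> U" and g': "total_map g'" "recursion_closed a h g'" "maps g' n k"
      using omega_elems_in_U unfolding total_map_def recursion_closed_def by blast
    obtain y' where y': "y' \<in> U" "maps g n y'" "maps g' n y'"
      using recursion_closed_agree[OF g(3,1) g'(2) \<open>g' \<in> U\<close> a h n] by blast
    have "y' = y" using total_map_unique[OF g(2) n y'(1) y(1)] y'(2) y(3) by blast
    moreover have "k = y'" using total_map_unique[OF g'(1) n \<open>k \<in> U\<close> y'(1)] g'(3) y'(3) by blast
    ultimately show "k = y" by simp
  qed
  with y show "recursion a h n \<in> omega_elems" "maps g n (recursion a h n)" by auto
qed

end

section \<open>Arithmetic with definable induction\<close>

text \<open>\<open>Def\<close> abstracts definability over omega, with the operations entering
  through their graphs. \<open>induct\<close> has no parameters, since a fixed element of omega is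
  not a definable term; hence the inductions below universally quantify all variables other than the
  induction variable.\<close>

locale peano = arithmetic N for N :: "'a nat_structure" (structure) +
  fixes Def :: "((nat \<Rightarrow> 'a) \<Rightarrow> bool) \<Rightarrow> bool"
  assumes zero_closed [simp]: "\<zero> \<in> \<omega>"
    and suc_closed [simp]: "x \<in> \<omega> \<Longrightarrow> \<S> x \<in> \<omega>"
    and add_closed [simp]: "x \<in> \<omega> \<Longrightarrow> y \<in> \<omega> \<Longrightarrow> x \<oplus> y \<in> \<omega>"
    and mul_closed [simp]: "x \<in> \<omega> \<Longrightarrow> y \<in> \<omega> \<Longrightarrow> x \<otimes> y \<in> \<omega>"
    and exp_closed [simp]: "x \<in> \<omega> \<Longrightarrow> y \<in> \<omega> \<Longrightarrow> x \<up> y \<in> \<omega>"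
    and suc_neq_zero [simp]: "x \<in> \<omega> \<Longrightarrow> \<S> x \<noteq> \<zero>"
    and suc_inj: "x \<in> \<omega> \<Longrightarrow> y \<in> \<omega> \<Longrightarrow> \<S> x = \<S> y \<Longrightarrow> x = y"
    and add_zero [simp]: "x \<in> \<omega> \<Longrightarrow> x \<oplus> \<zero> = x"
    and add_suc [simp]: "x \<in> \<omega> \<Longrightarrow> y \<in> \<omega> \<Longrightarrow> x \<oplus> \<S> y = \<S> (x \<oplus> y)"
    and mul_zero [simp]: "x \<in> \<omega> \<Longrightarrow> x \<otimes> \<zero> = \<zero>"
    and mul_suc [simp]: "x \<in> \<omega> \<Longrightarrow> y \<in> \<omega> \<Longrightarrow> x \<otimes> \<S> y = x \<otimes> y \<oplus> x"
    and exp_zero [simp]: "x \<in> \<omega> \<Longrightarrow> x \<up> \<zero> = \<S> \<zero>"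
    and exp_suc [simp]: "x \<in> \<omega> \<Longrightarrow> y \<in> \<omega> \<Longrightarrow> x \<up> \<S> y = x \<up> y \<otimes> x"
    and not_less_zero [simp]: "x \<in> \<omega> \<Longrightarrow> \<not> x \<prec> \<zero>"
    and less_suc_iff: "x \<in> \<omega> \<Longrightarrow> y \<in> \<omega> \<Longrightarrow> x \<prec> \<S> y \<longleftrightarrow> x \<prec> y \<or> x = y"
    and induct: "Def (\<lambda>v. A (v 0)) \<Longrightarrow> A \<zero> \<Longrightarrow>
      (\<And>n. n \<in> \<omega> \<Longrightarrow> A n \<Longrightarrow> A (\<S> n)) \<Longrightarrow> n \<in> \<omega> \<Longrightarrow> A n"
    and Def_cong: "Def Q \<Longrightarrow> (\<And>v. range v \<subseteq> \<omega> \<Longrightarrow> P v \<longleftrightarrow> Q v) \<Longrightarrow> Def P"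
    and Def_rename: "Def P \<Longrightarrow> Def (\<lambda>v. P (\<lambda>i. v (\<sigma> i)))"
    and Def_not: "Def P \<Longrightarrow> Def (\<lambda>v. \<not> P v)"
    and Def_imp: "Def P \<Longrightarrow> Def Q \<Longrightarrow> Def (\<lambda>v. P v \<longrightarrow> Q v)"
    and Def_all: "Def (\<lambda>v. R (\<lambda>i. v (Suc i)) (v 0)) \<Longrightarrow> Def (\<lambda>v. \<forall>x\<in>\<omega>. R v x)"
    and Def_eq_var: "Def (\<lambda>v. v i = v j)"
    and Def_less_var: "Def (\<lambda>v. v i \<prec> v j)"
    and Def_zero_var: "Def (\<lambda>v. \<zero> = v i)"
    and Def_suc_var: "Def (\<lambda>v. \<S> (v i) = v j)"
    and Def_add_var: "Def (\<lambda>v. v i \<oplus> v j = v k)"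
    and Def_mul_var: "Def (\<lambda>v. v i \<otimes> v j = v k)"
    and Def_exp_var: "Def (\<lambda>v. v i \<up> v j = v k)"
begin

subsection \<open>Definable predicates and terms\<close>

lemma Def_conj: "Def P \<Longrightarrow> Def Q \<Longrightarrow> Def (\<lambda>v. P v \<and> Q v)"
  using Def_not[OF Def_imp[OF _ Def_not], of P Q] by simp

lemma Def_disj: "Def P \<Longrightarrow> Def Q \<Longrightarrow> Def (\<lambda>v. P v \<or> Q v)"
  using Def_imp[OF Def_not, of P Q] by (simp add: disj_imp)

lemma Def_ex: "Def (\<lambda>v. R (\<lambda>i. v (Suc i)) (v 0)) \<Longrightarrow> Def (\<lambda>v. \<exists>x\<in>\<omega>. R v x)"
  using Def_not[OF Def_all[of "\<lambda>v x. \<not> R v x", OF Def_not]] by simp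

text \<open>A term is a map whose graph is definable, with the value in variable 0 and the arguments
  shifted by one. Such maps can be composed although \<open>Def\<close> knows only graphs.\<close>

definition Term :: "((nat \<Rightarrow> 'a) \<Rightarrow> 'a) \<Rightarrow> bool" where
  "Term t \<longleftrightarrow> (\<forall>v. range v \<subseteq> \<omega> \<longrightarrow> t v \<in> \<omega>) \<and> Def (\<lambda>v. t (\<lambda>i. v (Suc i)) = v 0)"

lemma Term_in: "Term t \<Longrightarrow> range v \<subseteq> \<omega> \<Longrightarrow> t v \<in> \<omega>"
  by (simp add: Term_def)

lemma Term_graph: "Term t \<Longrightarrow> Def (\<lambda>v. t (\<lambda>i. v (\<sigma> i)) = v k)"
  unfolding Term_def
  using Def_rename[of "\<lambda>v. t (\<lambda>i. v (Suc i)) = v 0" "\<lambda>n. case n of 0 \<Rightarrow> k | Suc i \<Rightarrow> \<sigma> i"] by simp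

lemma Term_shift:
  assumes "Term t" shows "Term (\<lambda>v. t (\<lambda>i. v (\<sigma> i)))"
  unfolding Term_def
proof (intro conjI allI impI)
  show "t (\<lambda>i. v (\<sigma> i)) \<in> \<omega>" if "range v \<subseteq> \<omega>" for v
    using that by (intro Term_in[OF assms]) auto
  show "Def (\<lambda>v. t (\<lambda>i. v (Suc (\<sigma> i))) = v 0)"
    using Term_graph[OF assms, of "\<lambda>i. Suc (\<sigma> i)" 0] .
qed

text \<open>Substitution is expressed by quantifying over the values of s and t. The third place
  serves as the value when R is the graph of a binary operation, and is ignored when R is a binary
  relation.\<close>

lemma Def_subst2:
  assumes R: "\<And>i j k. Def (\<lambda>v. R (v i) (v j) (v k))" and s: "Term s" and t: "Term t"
  shows "Def (\<lambda>v. R (s v) (t v) (v k))"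
proof (rule Def_cong)
  show "Def (\<lambda>v. \<exists>x\<in>\<omega>. \<exists>y\<in>\<omega>. s v = x \<and> t v = y \<and> R x y (v k))"
    by (intro Def_ex Def_conj Term_graph[OF s] Term_graph[OF t] R)
qed (use Term_in[OF s] Term_in[OF t] in blast)

lemma Term_binary:
  assumes R: "\<And>i j k. Def (\<lambda>v. f (v i) (v j) = v k)" and s: "Term s" and t: "Term t"
    and f: "\<And>x y. x \<in> \<omega> \<Longrightarrow> y \<in> \<omega> \<Longrightarrow> f x y \<in> \<omega>"
  shows "Term (\<lambda>v. f (s v) (t v))"
  unfolding Term_def
proof (intro conjI allI impI)
  show "f (s v) (t v) \<in> \<omega>" if "range v \<subseteq> \<omega>" for v
    using Term_in[OF s that] Term_in[OF t that] by (rule f)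
  show "Def (\<lambda>v. f (s (\<lambda>i. v (Suc i))) (t (\<lambda>i. v (Suc i))) = v 0)"
    by (rule Def_subst2[of "\<lambda>x y z. f x y = z", OF R Term_shift[OF s] Term_shift[OF t]])
qed

lemma Term_var: "Term (\<lambda>v. v i)"
  unfolding Term_def by (auto intro: Def_eq_var)

lemma Term_zero: "Term (\<lambda>v. \<zero>)"
  unfolding Term_def by (auto intro: Def_zero_var)

lemma Term_suc: "Term t \<Longrightarrow> Term (\<lambda>v. \<S> (t v))"
  using Term_binary[of "\<lambda>x y. \<S> x" t t] by (simp add: Def_suc_var)

lemma Term_add: "Term s \<Longrightarrow> Term t \<Longrightarrow> Term (\<lambda>v. s v \<oplus> t v)"
  by (rule Term_binary[of "add N"]) (auto intro: Def_add_var)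

lemma Term_mul: "Term s \<Longrightarrow> Term t \<Longrightarrow> Term (\<lambda>v. s v \<otimes> t v)"
  by (rule Term_binary[of "mul N"]) (auto intro: Def_mul_var)

lemma Term_exp: "Term s \<Longrightarrow> Term t \<Longrightarrow> Term (\<lambda>v. s v \<up> t v)"
  by (rule Term_binary[of "exp N"]) (auto intro: Def_exp_var)

lemma num_closed [simp]: "num n \<in> \<omega>"
  by (induction n) auto

lemma Term_num: "Term (\<lambda>v. num n)"
  by (induction n) (auto intro: Term_zero Term_suc)

lemma Def_eq: "Term s \<Longrightarrow> Term t \<Longrightarrow> Def (\<lambda>v. s v = t v)"
  by (rule Def_subst2[of "\<lambda>x y _. x = y"]) (auto intro: Def_eq_var)

lemma Def_less: "Term s \<Longrightarrow> Term t \<Longrightarrow> Def (\<lambda>v. s v \<prec> t v)"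
  by (rule Def_subst2[of "\<lambda>x y _. x \<prec> y"]) (auto intro: Def_less_var)

lemma Def_le: "Term s \<Longrightarrow> Term t \<Longrightarrow> Def (\<lambda>v. s v \<preceq> t v)"
  unfolding le_def by (intro Def_disj Def_less Def_eq)

lemmas Def_intros = Def_not Def_imp Def_conj Def_disj Def_all Def_ex Def_eq Def_less Def_le
  Term_var Term_zero Term_suc Term_add Term_mul Term_exp Term_num

lemma suc_eq_iff [simp]: "x \<in> \<omega> \<Longrightarrow> y \<in> \<omega> \<Longrightarrow> \<S> x = \<S> y \<longleftrightarrow> x = y"
  using suc_inj by blast

subsection \<open>Addition, multiplication and exponentiation\<close>

lemma zero_add [simp]: "x \<in> \<omega> \<Longrightarrow> \<zero> \<oplus> x = x"
  by (rule induct[where A = "\<lambda>x. \<zero> \<oplus> x = x"]) (intro Def_intros, simp_all)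

lemma add_assoc:
  assumes "x \<in> \<omega>" "y \<in> \<omega>" "z \<in> \<omega>" shows "x \<oplus> y \<oplus> z = x \<oplus> (y \<oplus> z)"
proof -
  have "\<forall>x\<in>\<omega>. \<forall>y\<in>\<omega>. x \<oplus> y \<oplus> z = x \<oplus> (y \<oplus> z)"
    by (rule induct[where A = "\<lambda>z. \<forall>x\<in>\<omega>. \<forall>y\<in>\<omega>. x \<oplus> y \<oplus> z = x \<oplus> (y \<oplus> z)", OF _ _ _ assms(3)])
      (intro Def_intros, simp_all)
  then show ?thesis using assms by blast
qed

lemma suc_add [simp]:
  assumes "x \<in> \<omega>" "y \<in> \<omega>" shows "\<S> x \<oplus> y = \<S> (x \<oplus> y)"
proof -
  have "\<forall>x\<in>\<omega>. \<S> x \<oplus> y = \<S> (x \<oplus> y)"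
    by (rule induct[where A = "\<lambda>y. \<forall>x\<in>\<omega>. \<S> x \<oplus> y = \<S> (x \<oplus> y)", OF _ _ _ assms(2)])
      (intro Def_intros, simp_all)
  then show ?thesis using assms by blast
qed

lemma add_commute:
  assumes "x \<in> \<omega>" "y \<in> \<omega>" shows "x \<oplus> y = y \<oplus> x"
proof -
  have "\<forall>x\<in>\<omega>. x \<oplus> y = y \<oplus> x"
    by (rule induct[where A = "\<lambda>y. \<forall>x\<in>\<omega>. x \<oplus> y = y \<oplus> x", OF _ _ _ assms(2)])
      (intro Def_intros, simp_all)
  then show ?thesis using assms by blast
qed

lemma add_left_commute:
  "x \<in> \<omega> \<Longrightarrow> y \<in> \<omega> \<Longrightarrow> z \<in> \<omega> \<Longrightarrow> x \<oplus> (y \<oplus> z) = y \<oplus> (x \<oplus> z)"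
  by (simp add: add_assoc[symmetric] add_commute[of x y])

lemmas add_ac = add_assoc add_commute add_left_commute

lemma add_right_cancel:
  assumes "x \<in> \<omega>" "y \<in> \<omega>" "z \<in> \<omega>" "x \<oplus> z = y \<oplus> z" shows "x = y"
proof -
  have "\<forall>x\<in>\<omega>. \<forall>y\<in>\<omega>. x \<oplus> z = y \<oplus> z \<longrightarrow> x = y"
  proof (rule induct[where A = "\<lambda>z. \<forall>x\<in>\<omega>. \<forall>y\<in>\<omega>. x \<oplus> z = y \<oplus> z \<longrightarrow> x = y", OF _ _ _ assms(3)])
    fix n assume n: "n \<in> \<omega>" and IH: "\<forall>x\<in>\<omega>. \<forall>y\<in>\<omega>. x \<oplus> n = y \<oplus> n \<longrightarrow> x = y"
    have "x \<oplus> \<S> n = y \<oplus> \<S> n \<longleftrightarrow> x \<oplus> n = y \<oplus> n" if "x \<in> \<omega>" "y \<in> \<omega>" for x y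
      using that n by simp
    with IH show "\<forall>x\<in>\<omega>. \<forall>y\<in>\<omega>. x \<oplus> \<S> n = y \<oplus> \<S> n \<longrightarrow> x = y" by blast
  qed (intro Def_intros, simp)
  then show ?thesis using assms by blast
qed

lemma zero_mul [simp]: "x \<in> \<omega> \<Longrightarrow> \<zero> \<otimes> x = \<zero>"
  by (rule induct[where A = "\<lambda>x. \<zero> \<otimes> x = \<zero>"]) (intro Def_intros, simp_all)

lemma suc_mul:
  assumes "x \<in> \<omega>" "y \<in> \<omega>" shows "\<S> x \<otimes> y = x \<otimes> y \<oplus> y"
proof -
  have "\<forall>x\<in>\<omega>. \<S> x \<otimes> y = x \<otimes> y \<oplus> y"
    by (rule induct[where A = "\<lambda>y. \<forall>x\<in>\<omega>. \<S> x \<otimes> y = x \<otimes> y \<oplus> y", OF _ _ _ assms(2)])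
      (intro Def_intros, simp_all add: add_ac)
  then show ?thesis using assms by blast
qed

lemma mul_commute:
  assumes "x \<in> \<omega>" "y \<in> \<omega>" shows "x \<otimes> y = y \<otimes> x"
proof -
  have "\<forall>x\<in>\<omega>. x \<otimes> y = y \<otimes> x"
    by (rule induct[where A = "\<lambda>y. \<forall>x\<in>\<omega>. x \<otimes> y = y \<otimes> x", OF _ _ _ assms(2)])
      (intro Def_intros, simp_all add: suc_mul)
  then show ?thesis using assms by blast
qed

lemma mul_add:
  assumes "x \<in> \<omega>" "y \<in> \<omega>" "z \<in> \<omega>" shows "x \<otimes> (y \<oplus> z) = x \<otimes> y \<oplus> x \<otimes> z"
proof -
  have "\<forall>x\<in>\<omega>. \<forall>y\<in>\<omega>. x \<otimes> (y \<oplus> z) = x \<otimes> y \<oplus> x \<otimes> z"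
    by (rule induct[where A = "\<lambda>z. \<forall>x\<in>\<omega>. \<forall>y\<in>\<omega>. x \<otimes> (y \<oplus> z) = x \<otimes> y \<oplus> x \<otimes> z", OF _ _ _ assms(3)])
      (intro Def_intros, simp_all add: add_ac)
  then show ?thesis using assms by blast
qed

lemma add_mul:
  "x \<in> \<omega> \<Longrightarrow> y \<in> \<omega> \<Longrightarrow> z \<in> \<omega> \<Longrightarrow> (x \<oplus> y) \<otimes> z = x \<otimes> z \<oplus> y \<otimes> z"
  by (simp add: mul_commute[of _ z] mul_add)

lemma mul_assoc:
  assumes "x \<in> \<omega>" "y \<in> \<omega>" "z \<in> \<omega>" shows "x \<otimes> y \<otimes> z = x \<otimes> (y \<otimes> z)"
proof -
  have "\<forall>x\<in>\<omega>. \<forall>y\<in>\<omega>. x \<otimes> y \<otimes> z = x \<otimes> (y \<otimes> z)"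
    by (rule induct[where A = "\<lambda>z. \<forall>x\<in>\<omega>. \<forall>y\<in>\<omega>. x \<otimes> y \<otimes> z = x \<otimes> (y \<otimes> z)", OF _ _ _ assms(3)])
      (intro Def_intros, simp_all add: mul_add)
  then show ?thesis using assms by blast
qed

lemma exp_add:
  assumes "x \<in> \<omega>" "y \<in> \<omega>" "z \<in> \<omega>" shows "x \<up> (y \<oplus> z) = x \<up> y \<otimes> x \<up> z"
proof -
  have "\<forall>x\<in>\<omega>. \<forall>y\<in>\<omega>. x \<up> (y \<oplus> z) = x \<up> y \<otimes> x \<up> z"
    by (rule induct[where A = "\<lambda>z. \<forall>x\<in>\<omega>. \<forall>y\<in>\<omega>. x \<up> (y \<oplus> z) = x \<up> y \<otimes> x \<up> z", OF _ _ _ assms(3)])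
      (intro Def_intros, simp_all add: mul_assoc)
  then show ?thesis using assms by blast
qed

lemma zero_or_suc: "x \<in> \<omega> \<Longrightarrow> x = \<zero> \<or> (\<exists>y\<in>\<omega>. x = \<S> y)"
  by (rule induct[where A = "\<lambda>x. x = \<zero> \<or> (\<exists>y\<in>\<omega>. x = \<S> y)"]) (intro Def_intros, auto)

lemma bex_omega_iff: "(\<exists>d\<in>\<omega>. Q d) \<longleftrightarrow> Q \<zero> \<or> (\<exists>d\<in>\<omega>. Q (\<S> d))"
  using zero_or_suc zero_closed suc_closed by blast

lemma add_eq_zero:
  assumes "x \<in> \<omega>" "y \<in> \<omega>" "x \<oplus> y = \<zero>" shows "x = \<zero> \<and> y = \<zero>"
  using zero_or_suc[OF assms(1)] zero_or_suc[OF assms(2)] assms by auto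

subsection \<open>The ordering\<close>

text \<open>In a model the order is membership, and the locale describes it only below zero and
  below a successor. Those two clauses determine it by recursion, and the right side obeys the same
  recursion; the other laws of the order then follow from addition.\<close>

lemma less_iff_add:
  assumes "x \<in> \<omega>" "y \<in> \<omega>" shows "x \<prec> y \<longleftrightarrow> (\<exists>d\<in>\<omega>. x \<oplus> \<S> d = y)"
proof -
  \<comment> \<open>The equivalence is spelled out as two implications because
    \<open>Def_intros\<close> has no rule for equivalences.\<close>
  have "\<forall>x\<in>\<omega>. (x \<prec> y \<longrightarrow> (\<exists>d\<in>\<omega>. x \<oplus> \<S> d = y)) \<and> ((\<exists>d\<in>\<omega>. x \<oplus> \<S> d = y) \<longrightarrow> x \<prec> y)"
  proof (rule induct[where A = "\<lambda>y. \<forall>x\<in>\<omega>. (x \<prec> y \<longrightarrow> (\<exists>d\<in>\<omega>. x \<oplus> \<S> d = y)) \<and>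
        ((\<exists>d\<in>\<omega>. x \<oplus> \<S> d = y) \<longrightarrow> x \<prec> y)", OF _ _ _ assms(2)])
    fix y assume y: "y \<in> \<omega>" and IH: "\<forall>x\<in>\<omega>. (x \<prec> y \<longrightarrow> (\<exists>d\<in>\<omega>. x \<oplus> \<S> d = y)) \<and>
        ((\<exists>d\<in>\<omega>. x \<oplus> \<S> d = y) \<longrightarrow> x \<prec> y)"
    have "x \<prec> \<S> y \<longleftrightarrow> (\<exists>d\<in>\<omega>. x \<oplus> \<S> d = \<S> y)" if x: "x \<in> \<omega>" for x
    proof -
      have "(\<exists>d\<in>\<omega>. x \<oplus> \<S> d = \<S> y) \<longleftrightarrow> (\<exists>d\<in>\<omega>. x \<oplus> d = y)"
        using x y by (intro bex_cong) simp_all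
      also have "\<dots> \<longleftrightarrow> x = y \<or> (\<exists>d\<in>\<omega>. x \<oplus> \<S> d = y)"
        using zero_or_suc bex_omega_iff[of "\<lambda>d. x \<oplus> d = y"] x by simp
      also have "\<dots> \<longleftrightarrow> x \<prec> \<S> y" using IH x y less_suc_iff by blast
      finally show ?thesis by blast
    qed
    then show "\<forall>x\<in>\<omega>. (x \<prec> \<S> y \<longrightarrow> (\<exists>d\<in>\<omega>. x \<oplus> \<S> d = \<S> y)) \<and>
        ((\<exists>d\<in>\<omega>. x \<oplus> \<S> d = \<S> y) \<longrightarrow> x \<prec> \<S> y)" by blast
  qed (intro Def_intros, auto)
  then show ?thesis using assms by blast
qed

lemma le_iff_add:
  assumes "x \<in> \<omega>" "y \<in> \<omega>" shows "x \<preceq> y \<longleftrightarrow> (\<exists>d\<in>\<omega>. x \<oplus> d = y)"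
  unfolding le_def less_iff_add[OF assms] bex_omega_iff[of "\<lambda>d. x \<oplus> d = y"]
  using assms by auto

lemma less_suc_iff_le: "x \<in> \<omega> \<Longrightarrow> y \<in> \<omega> \<Longrightarrow> x \<prec> \<S> y \<longleftrightarrow> x \<preceq> y"
  by (simp add: less_suc_iff le_def)

lemma suc_le_iff: "x \<in> \<omega> \<Longrightarrow> y \<in> \<omega> \<Longrightarrow> \<S> x \<preceq> y \<longleftrightarrow> x \<prec> y"
  by (simp add: le_iff_add less_iff_add)

lemma le_refl [simp]: "x \<preceq> x"
  by (simp add: le_def)

lemma less_irrefl [simp]: "x \<in> \<omega> \<Longrightarrow> \<not> x \<prec> x"
proof
  assume x: "x \<in> \<omega>" and "x \<prec> x"
  then obtain d where "d \<in> \<omega>" "x \<oplus> \<S> d = x" using less_iff_add by blast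
  then have "\<S> d \<oplus> x = \<zero> \<oplus> x" using x by (simp add: add_commute)
  then show False using add_right_cancel[of "\<S> d" \<zero> x] x \<open>d \<in> \<omega>\<close> by simp
qed

lemma le_trans:
  assumes "x \<in> \<omega>" "y \<in> \<omega>" "z \<in> \<omega>" "x \<preceq> y" "y \<preceq> z" shows "x \<preceq> z"
  using assms by (auto simp: le_iff_add add_assoc intro!: bexI)

lemma less_le_trans:
  assumes "x \<in> \<omega>" "y \<in> \<omega>" "z \<in> \<omega>" "x \<prec> y" "y \<preceq> z" shows "x \<prec> z"
  using le_trans[of "\<S> x" y z] assms by (simp add: suc_le_iff)

lemma le_less_trans:
  assumes "x \<in> \<omega>" "y \<in> \<omega>" "z \<in> \<omega>" "x \<preceq> y" "y \<prec> z" shows "x \<prec> z"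
  using le_trans[of "\<S> x" "\<S> y" z] assms less_suc_iff_le[of x y]
  by (simp add: suc_le_iff)

lemma not_less_iff_le:
  assumes "x \<in> \<omega>" "y \<in> \<omega>" shows "\<not> x \<prec> y \<longleftrightarrow> y \<preceq> x"
proof -
  have "\<forall>y\<in>\<omega>. x \<prec> y \<or> y \<preceq> x"
  proof (rule induct[where A = "\<lambda>x. \<forall>y\<in>\<omega>. x \<prec> y \<or> y \<preceq> x", OF _ _ _ assms(1)])
    show "\<forall>y\<in>\<omega>. \<zero> \<prec> y \<or> y \<preceq> \<zero>"
    proof
      fix y assume y: "y \<in> \<omega>"
      from zero_or_suc[OF y] y show "\<zero> \<prec> y \<or> y \<preceq> \<zero>"
        by (auto simp: less_iff_add)
    qed
    show "\<forall>y\<in>\<omega>. \<S> n \<prec> y \<or> y \<preceq> \<S> n" if n: "n \<in> \<omega>" "\<forall>y\<in>\<omega>. n \<prec> y \<or> y \<preceq> n" for n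
    proof
      fix y assume y: "y \<in> \<omega>"
      have "\<S> n \<preceq> y \<or> y \<prec> \<S> n" using n y by (simp add: suc_le_iff less_suc_iff_le)
      then show "\<S> n \<prec> y \<or> y \<preceq> \<S> n" unfolding le_def by blast
    qed
  qed (intro Def_intros)
  moreover have "\<not> y \<preceq> x" if "x \<prec> y" using less_le_trans[of x y x] that assms by auto
  ultimately show ?thesis using assms by blast
qed

lemma le_antisym: "x \<in> \<omega> \<Longrightarrow> y \<in> \<omega> \<Longrightarrow> x \<preceq> y \<Longrightarrow> y \<preceq> x \<Longrightarrow> x = y"
  using not_less_iff_le[of x y] unfolding le_def by blast

lemma zero_le [simp]: "x \<in> \<omega> \<Longrightarrow> \<zero> \<preceq> x"
  by (simp add: le_iff_add)

lemma pos_iff: "x \<in> \<omega> \<Longrightarrow> \<S> \<zero> \<preceq> x \<longleftrightarrow> x \<noteq> \<zero>"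
  using zero_or_suc[of x] by (auto simp: le_iff_add)

section \<open>The least number principle\<close>

lemma least_eqI:
  assumes "m \<in> \<omega>" "P m" "\<And>j. j \<in> \<omega> \<Longrightarrow> P j \<Longrightarrow> m \<preceq> j" shows "least P = m"
  unfolding least_def using assms by (intro the_equality) (auto intro: le_antisym)

text \<open>By induction on k, either a least solution exists or all solutions exceed k; a solution
  k excludes the second alternative. The parameter y is quantified inside the induction
  predicate.\<close>

lemma ex_least:
  assumes D: "Def (\<lambda>v. P (v 0) (v 1))" and "k \<in> \<omega>" "y \<in> \<omega>" "P k y"
  obtains m where "m \<in> \<omega>" "P m y" "\<And>j. j \<in> \<omega> \<Longrightarrow> P j y \<Longrightarrow> m \<preceq> j"
proof -
  have D': "Def (\<lambda>v. P (v i) (v j))" for i j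
    using Def_rename[OF D, of "\<lambda>n. if n = 0 then i else j"] by simp
  have "\<forall>y\<in>\<omega>. (\<exists>m\<in>\<omega>. P m y \<and> (\<forall>j\<in>\<omega>. P j y \<longrightarrow> m \<preceq> j)) \<or> (\<forall>j\<in>\<omega>. P j y \<longrightarrow> k \<prec> j)"
  proof (rule induct[where A = "\<lambda>k. \<forall>y\<in>\<omega>. (\<exists>m\<in>\<omega>. P m y \<and> (\<forall>j\<in>\<omega>. P j y \<longrightarrow> m \<preceq> j)) \<or>
        (\<forall>j\<in>\<omega>. P j y \<longrightarrow> k \<prec> j)", OF _ _ _ \<open>k \<in> \<omega>\<close>])
    show "\<forall>y\<in>\<omega>. (\<exists>m\<in>\<omega>. P m y \<and> (\<forall>j\<in>\<omega>. P j y \<longrightarrow> m \<preceq> j)) \<or> (\<forall>j\<in>\<omega>. P j y \<longrightarrow> \<zero> \<prec> j)"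
      using zero_le zero_closed unfolding le_def by metis
    show "\<forall>y\<in>\<omega>. (\<exists>m\<in>\<omega>. P m y \<and> (\<forall>j\<in>\<omega>. P j y \<longrightarrow> m \<preceq> j)) \<or> (\<forall>j\<in>\<omega>. P j y \<longrightarrow> \<S> n \<prec> j)"
      if "n \<in> \<omega>" and IH: "\<forall>y\<in>\<omega>. (\<exists>m\<in>\<omega>. P m y \<and> (\<forall>j\<in>\<omega>. P j y \<longrightarrow> m \<preceq> j)) \<or>
        (\<forall>j\<in>\<omega>. P j y \<longrightarrow> n \<prec> j)" for n
    proof
      fix y assume y: "y \<in> \<omega>"
      have "(\<exists>m\<in>\<omega>. P m y \<and> (\<forall>j\<in>\<omega>. P j y \<longrightarrow> m \<preceq> j)) \<or> (\<forall>j\<in>\<omega>. P j y \<longrightarrow> \<S> n \<preceq> j)"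
        using IH y suc_le_iff[OF \<open>n \<in> \<omega>\<close>] by blast
      then show "(\<exists>m\<in>\<omega>. P m y \<and> (\<forall>j\<in>\<omega>. P j y \<longrightarrow> m \<preceq> j)) \<or> (\<forall>j\<in>\<omega>. P j y \<longrightarrow> \<S> n \<prec> j)"
        using suc_closed[OF \<open>n \<in> \<omega>\<close>] unfolding le_def by metis
    qed
  qed (intro Def_intros D')
  then show thesis using that assms less_irrefl by blast
qed

section \<open>Monotonicity of the operations\<close>

lemma add_left_mono:
  "x \<in> \<omega> \<Longrightarrow> y \<in> \<omega> \<Longrightarrow> z \<in> \<omega> \<Longrightarrow> x \<prec> y \<Longrightarrow> z \<oplus> x \<prec> z \<oplus> y"
  by (auto simp: less_iff_add add_assoc)

lemma le_add: "x \<in> \<omega> \<Longrightarrow> y \<in> \<omega> \<Longrightarrow> x \<preceq> x \<oplus> y"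
  by (auto simp: le_iff_add)

lemma mul_right_mono:
  assumes "x \<in> \<omega>" "y \<in> \<omega>" "z \<in> \<omega>" "x \<preceq> y" shows "x \<otimes> z \<preceq> y \<otimes> z"
  using assms by (auto simp: le_iff_add add_mul)

lemma mul_eq_zero:
  assumes "x \<in> \<omega>" "y \<in> \<omega>" "x \<otimes> y = \<zero>" shows "x = \<zero> \<or> y = \<zero>"
proof (rule disjCI)
  assume "y \<noteq> \<zero>"
  then obtain z where "z \<in> \<omega>" "y = \<S> z" using zero_or_suc assms by blast
  then show "x = \<zero>" using add_eq_zero[of "x \<otimes> z" x] assms by simp
qed

lemma exp_neq_zero:
  assumes "b \<in> \<omega>" "b \<noteq> \<zero>" "x \<in> \<omega>" shows "b \<up> x \<noteq> \<zero>"
proof -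
  have "\<forall>b\<in>\<omega>. b \<noteq> \<zero> \<longrightarrow> b \<up> x \<noteq> \<zero>"
  proof (rule induct[where A = "\<lambda>x. \<forall>b\<in>\<omega>. b \<noteq> \<zero> \<longrightarrow> b \<up> x \<noteq> \<zero>", OF _ _ _ assms(3)])
    fix n assume "n \<in> \<omega>" and "\<forall>b\<in>\<omega>. b \<noteq> \<zero> \<longrightarrow> b \<up> n \<noteq> \<zero>"
    then show "\<forall>b\<in>\<omega>. b \<noteq> \<zero> \<longrightarrow> b \<up> \<S> n \<noteq> \<zero>"
      using mul_eq_zero[of "_ \<up> n"] by (metis exp_closed exp_suc)
  qed (intro Def_intros, simp)
  then show ?thesis using assms by blast
qed

lemma exp_mono:
  assumes "b \<in> \<omega>" "b \<noteq> \<zero>" "x \<in> \<omega>" "y \<in> \<omega>" "x \<preceq> y" shows "b \<up> x \<preceq> b \<up> y"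
proof -
  obtain d where d: "d \<in> \<omega>" "x \<oplus> d = y" using assms le_iff_add by blast
  have "\<S> \<zero> \<preceq> b \<up> d" using pos_iff exp_neq_zero assms d by simp
  then have "\<S> \<zero> \<otimes> b \<up> x \<preceq> b \<up> d \<otimes> b \<up> x" using assms d by (intro mul_right_mono) auto
  then show ?thesis using d assms exp_add[of b x d] mul_commute[of "b \<up> d" "b \<up> x"] by (auto simp: suc_mul)
qed

subsection \<open>Lengths of decimal representations\<close>

lemma ten_neq_zero [simp]: "num 10 \<noteq> \<zero>"
  by (simp add: numeral_eq_Suc)

lemma double_less_ten_times:
  assumes "y \<in> \<omega>" "y \<noteq> \<zero>" shows "y \<oplus> y \<prec> y \<otimes> num 10"
proof -
  have "num 10 = \<S> (\<S> (num 8))" by (simp add: numeral_eq_Suc)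
  then have "y \<otimes> num 10 = (y \<oplus> y) \<oplus> y \<otimes> num 8" using assms by (simp add: add_ac)
  moreover have "num 8 \<noteq> \<zero>" by (simp add: numeral_eq_Suc)
  then have "y \<otimes> num 8 \<noteq> \<zero>" using assms mul_eq_zero[of y "num 8"] by auto
  then obtain d where "d \<in> \<omega>" "y \<otimes> num 8 = \<S> d"
    using zero_or_suc[of "y \<otimes> num 8"] assms by auto
  ultimately show ?thesis using assms less_iff_add[of "y \<oplus> y" "y \<otimes> num 10"] by auto
qed

lemma less_ten_times:
  assumes "y \<in> \<omega>" "y \<noteq> \<zero>" shows "y \<prec> y \<otimes> num 10"
  using le_less_trans[of y "y \<oplus> y" "y \<otimes> num 10"] le_add double_less_ten_times assms by simp

lemma less_ten_exp: "n \<in> \<omega> \<Longrightarrow> n \<prec> num 10 \<up> n"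
proof (rule induct[where A = "\<lambda>n. n \<prec> num 10 \<up> n"])
  show "\<zero> \<prec> num 10 \<up> \<zero>" by (simp add: less_suc_iff)
  show "\<S> n \<prec> num 10 \<up> \<S> n" if n: "n \<in> \<omega>" "n \<prec> num 10 \<up> n" for n
    using le_less_trans[of "\<S> n" "num 10 \<up> n" "num 10 \<up> \<S> n"] n
      suc_le_iff[of n "num 10 \<up> n"] less_ten_times[of "num 10 \<up> n"]
      exp_neq_zero[of "num 10" n] by simp
qed (intro Def_intros)

lemma len_eqI:
  assumes "x \<in> \<omega>" "j \<in> \<omega>" "num 10 \<up> j \<preceq> x" "x \<prec> num 10 \<up> \<S> j"
  shows "len x = \<S> j"
  unfolding len_def
proof (rule least_eqI)
  show "\<S> j \<in> \<omega>" using assms by simp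
  show "num 1 \<preceq> \<S> j \<and> x \<prec> num 10 \<up> \<S> j" using assms by (simp add: pos_iff del: exp_suc)
  fix k assume k: "k \<in> \<omega>" "num 1 \<preceq> k \<and> x \<prec> num 10 \<up> k"
  show "\<S> j \<preceq> k"
  proof (rule ccontr)
    assume "\<not> \<S> j \<preceq> k"
    then have "k \<preceq> j" using assms k not_less_iff_le[of j k] suc_le_iff[of j k] by simp
    then have "num 10 \<up> k \<preceq> num 10 \<up> j" using assms k by (intro exp_mono) auto
    then have "num 10 \<up> k \<preceq> x" using assms k le_trans[of "num 10 \<up> k" "num 10 \<up> j" x] by simp
    then show False using k assms not_less_iff_le[of x "num 10 \<up> k"] by simp
  qed
qed

lemma ex_leading_exponent:
  assumes "x \<in> \<omega>" "x \<noteq> \<zero>"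
  obtains j where "j \<in> \<omega>" "num 10 \<up> j \<preceq> x" "x \<prec> num 10 \<up> \<S> j"
proof -
  have "x = \<zero> \<or> (\<exists>j\<in>\<omega>. num 10 \<up> j \<preceq> x \<and> x \<prec> num 10 \<up> \<S> j)"
  proof (rule induct[where A = "\<lambda>x. x = \<zero> \<or> (\<exists>j\<in>\<omega>. num 10 \<up> j \<preceq> x \<and> x \<prec> num 10 \<up> \<S> j)",
        OF _ _ _ assms(1)])
    fix n assume n: "n \<in> \<omega>" and "n = \<zero> \<or> (\<exists>j\<in>\<omega>. num 10 \<up> j \<preceq> n \<and> n \<prec> num 10 \<up> \<S> j)"
    then consider "n = \<zero>" | j where "j \<in> \<omega>" "num 10 \<up> j \<preceq> n" "n \<prec> num 10 \<up> \<S> j" by blast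
    then have "\<exists>j\<in>\<omega>. num 10 \<up> j \<preceq> \<S> n \<and> \<S> n \<prec> num 10 \<up> \<S> j"
    proof cases
      case 1
      have "\<S> \<zero> \<prec> num 10 \<up> \<S> \<zero>" using less_ten_exp[of "\<S> \<zero>"] by (simp del: exp_suc)
      then show ?thesis using 1 by (intro bexI[of _ \<zero>]) (auto simp del: exp_suc)
    next
      case 2
      have "\<S> n \<preceq> num 10 \<up> \<S> j" using 2 n suc_le_iff by simp
      \<comment> \<open>The leading exponent changes only when the successor of n reaches the next
        power of ten.\<close>
      then consider "\<S> n \<prec> num 10 \<up> \<S> j" | "\<S> n = num 10 \<up> \<S> j" unfolding le_def by blast
      then show ?thesis
      proof cases
        case 1
        have "num 10 \<up> j \<preceq> \<S> n"
          using le_trans[of "num 10 \<up> j" n "\<S> n"] 2 n by (simp add: le_def less_suc_iff)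
        with 1 2 show ?thesis by blast
      next
        case eq: 2
        have "num 10 \<up> \<S> j \<prec> num 10 \<up> \<S> j \<otimes> num 10"
          using 2 by (intro less_ten_times exp_neq_zero) auto
        then have "\<S> n \<prec> num 10 \<up> \<S> (\<S> j)"
          unfolding eq using exp_suc[of "num 10" "\<S> j"] 2 by simp
        then show ?thesis using 2 eq by (intro bexI[of _ "\<S> j"]) (auto simp del: exp_suc)
      qed
    qed
    then show "\<S> n = \<zero> \<or> (\<exists>j\<in>\<omega>. num 10 \<up> j \<preceq> \<S> n \<and> \<S> n \<prec> num 10 \<up> \<S> j)" ..
  qed (intro Def_intros, simp)
  then show thesis using that assms by blast
qed

text \<open>The clause \<open>num 1 \<preceq> k\<close> in \<open>len\<close> decides here: the
  exponent zero would already satisfy 0 < 10^0.\<close>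

lemma len_zero: "len \<zero> = \<S> \<zero>"
  unfolding len_def
proof (rule least_eqI)
  have "\<zero> \<prec> num 10 \<up> \<S> \<zero>"
    using le_less_trans[of \<zero> "\<S> \<zero>" "num 10 \<up> \<S> \<zero>"] less_ten_exp[of "\<S> \<zero>"] by simp
  then show "num 1 \<preceq> \<S> \<zero> \<and> \<zero> \<prec> num 10 \<up> \<S> \<zero>" by simp
qed simp_all

lemma len_cases:
  assumes "x \<in> \<omega>"
  obtains "x = \<zero>" "len x = \<S> \<zero>" |
    j where "j \<in> \<omega>" "len x = \<S> j" "num 10 \<up> j \<preceq> x" "x \<prec> num 10 \<up> \<S> j"
  using len_zero ex_leading_exponent[OF assms] len_eqI[OF assms] by metis

lemma len_closed [simp]: "x \<in> \<omega> \<Longrightarrow> len x \<in> \<omega>"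
  by (rule len_cases) auto

lemma less_ten_exp_len: "x \<in> \<omega> \<Longrightarrow> x \<prec> num 10 \<up> len x"
  by (erule len_cases) (use less_ten_exp[of "\<S> \<zero>"] le_less_trans[of \<zero> "\<S> \<zero>" "num 10 \<up> \<S> \<zero>"] in auto)

lemma len_neq_zero: "x \<in> \<omega> \<Longrightarrow> len x \<noteq> \<zero>"
  by (erule len_cases) auto

lemma len_least:
  assumes "x \<in> \<omega>" "k \<in> \<omega>" "num 1 \<preceq> k" "x \<prec> num 10 \<up> k" shows "len x \<preceq> k"
proof (rule len_cases[OF assms(1)])
  assume "len x = \<S> \<zero>"
  then show ?thesis using assms by simp
next
  fix j assume j: "j \<in> \<omega>" "len x = \<S> j" "num 10 \<up> j \<preceq> x"
  show ?thesis
  proof (rule ccontr)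
    assume "\<not> len x \<preceq> k"
    then have "k \<preceq> j" using j assms not_less_iff_le[of j k] suc_le_iff[of j k] by simp
    then have "num 10 \<up> k \<preceq> num 10 \<up> j" using assms j by (intro exp_mono) auto
    then have "num 10 \<up> k \<preceq> x" using assms j le_trans[of "num 10 \<up> k" "num 10 \<up> j" x] by simp
    then show False using assms not_less_iff_le[of x "num 10 \<up> k"] by simp
  qed
qed

text \<open>The description in \<open>len\<close> is unfolded into an arithmetical condition on its
  value, from which \<open>Term_len\<close> obtains definability of the graph.\<close>

lemma len_eq_iff:
  assumes "x \<in> \<omega>" "k \<in> \<omega>"
  shows "len x = k \<longleftrightarrow> num 1 \<preceq> k \<and> x \<prec> num 10 \<up> k \<and>
     (\<forall>j\<in>\<omega>. num 1 \<preceq> j \<and> x \<prec> num 10 \<up> j \<longrightarrow> k \<preceq> j)"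
  using len_least[OF assms(1)] len_least[OF assms] less_ten_exp_len[OF assms(1)]
    pos_iff[of "len x"] len_neq_zero[OF assms(1)] len_closed[OF assms(1)]
    le_antisym[OF _ assms(2), of "len x"] by auto

lemma Term_len: assumes t: "Term t" shows "Term (\<lambda>v. len (t v))"
  unfolding Term_def
proof (intro conjI allI impI)
  show "len (t v) \<in> \<omega>" if "range v \<subseteq> \<omega>" for v using Term_in[OF t that] by simp
  show "Def (\<lambda>v. len (t (\<lambda>i. v (Suc i))) = v 0)"
  proof (rule Def_cong)
    fix v :: "nat \<Rightarrow> 'a" assume v: "range v \<subseteq> \<omega>"
    then have "t (\<lambda>i. v (Suc i)) \<in> \<omega>" "v 0 \<in> \<omega>" by (auto intro!: Term_in[OF t])
    then show "len (t (\<lambda>i. v (Suc i))) = v 0 \<longleftrightarrow> num 1 \<preceq> v 0 \<and> t (\<lambda>i. v (Suc i)) \<prec> num 10 \<up> v 0 \<and>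
     (\<forall>j\<in>\<omega>. num 1 \<preceq> j \<and> t (\<lambda>i. v (Suc i)) \<prec> num 10 \<up> j \<longrightarrow> v 0 \<preceq> j)" by (rule len_eq_iff)
  qed (intro Def_intros Term_shift[OF t])
qed

section \<open>Lengths of concatenations and codes\<close>

lemma append_closed [simp]: "x \<in> \<omega> \<Longrightarrow> y \<in> \<omega> \<Longrightarrow> append x y \<in> \<omega>"
  by (simp add: append_def)

text \<open>With K = 10^(len y) and j the leading exponent of x, the concatenation lies between 10^j
  K and 10^(j+1) K, because y < K. For x = 0 the equation fails: the leading zero disappears,
  although zero has length one.\<close>

lemma len_append:
  assumes x: "x \<in> \<omega>" "x \<noteq> \<zero>" and y: "y \<in> \<omega>"
  shows "len (append x y) = len x \<oplus> len y"
proof -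
  define K where "K = num 10 \<up> len y"
  have K: "K \<in> \<omega>" "y \<prec> K" using less_ten_exp_len y by (simp_all add: K_def)
  obtain j where j: "j \<in> \<omega>" "num 10 \<up> j \<preceq> x" "x \<prec> num 10 \<up> \<S> j"
    using ex_leading_exponent[OF x] .
  have exp_K: "num 10 \<up> (i \<oplus> len y) = num 10 \<up> i \<otimes> K" if "i \<in> \<omega>" for i
    using that y by (simp add: exp_add K_def)
  have "num 10 \<up> j \<otimes> K \<preceq> x \<otimes> K" using j x K by (intro mul_right_mono) auto
  then have lower: "num 10 \<up> (j \<oplus> len y) \<preceq> append x y"
    using le_trans[of "num 10 \<up> j \<otimes> K" "x \<otimes> K" "x \<otimes> K \<oplus> y"] le_add[of "x \<otimes> K" y] exp_K[of j] j x y K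
    by (simp add: append_def K_def[symmetric])
  have "x \<otimes> K \<oplus> y \<prec> \<S> x \<otimes> K" using add_left_mono[of y K "x \<otimes> K"] K x y by (simp add: suc_mul)
  moreover have "\<S> x \<otimes> K \<preceq> num 10 \<up> \<S> j \<otimes> K"
    using j x K suc_le_iff by (intro mul_right_mono) (auto simp del: exp_suc)
  ultimately have "x \<otimes> K \<oplus> y \<prec> num 10 \<up> \<S> j \<otimes> K"
    using less_le_trans[of "x \<otimes> K \<oplus> y" "\<S> x \<otimes> K" "num 10 \<up> \<S> j \<otimes> K"] j x y K by simp
  then have upper: "append x y \<prec> num 10 \<up> \<S> (j \<oplus> len y)"
    using exp_K[of "\<S> j"] j y by (simp add: append_def K_def[symmetric] del: exp_suc)
  have "len (append x y) = \<S> (j \<oplus> len y)"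
    using len_eqI[OF _ _ lower upper] x y j by simp
  also have "\<dots> = len x \<oplus> len y" using len_eqI[OF x(1) j] j y by simp
  finally show ?thesis .
qed

lemma append_neq_zero:
  assumes "x \<in> \<omega>" "x \<noteq> \<zero>" "y \<in> \<omega>" shows "append x y \<noteq> \<zero>"
  using assms add_eq_zero[of "x \<otimes> num 10 \<up> len y" y] mul_eq_zero[of x "num 10 \<up> len y"]
    exp_neq_zero[of "num 10" "len y"] by (auto simp: append_def)

lemma suc_nines:
  assumes "k \<in> \<omega>" shows "nines k \<in> \<omega>" "\<S> (nines k) = num 10 \<up> k"
proof -
  obtain r where r: "r \<in> \<omega>" "\<S> r = num 10 \<up> k"
    using zero_or_suc[of "num 10 \<up> k"] exp_neq_zero[of "num 10" k] assms by auto
  have "nines k = r"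
    unfolding nines_def using r by (intro the_equality) (auto intro: suc_inj)
  then show "nines k \<in> \<omega>" "\<S> (nines k) = num 10 \<up> k" using r by auto
qed

lemma len_nines:
  assumes "j \<in> \<omega>" shows "len (nines (\<S> j)) = \<S> j"
proof (rule len_eqI)
  note n = suc_nines[OF suc_closed[OF assms]]
  show "nines (\<S> j) \<in> \<omega>" "j \<in> \<omega>" using n assms by auto
  have "num 10 \<up> j \<prec> \<S> (nines (\<S> j))"
    unfolding n(2) using less_ten_times[of "num 10 \<up> j"] exp_neq_zero[of "num 10" j] assms by simp
  then show "num 10 \<up> j \<preceq> nines (\<S> j)" using less_suc_iff_le n(1) assms by simp
  show "nines (\<S> j) \<prec> num 10 \<up> \<S> j"
    unfolding n(2)[symmetric] using n(1) by (simp add: less_suc_iff)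
qed

lemma nines_suc_neq_zero:
  assumes "j \<in> \<omega>" shows "nines (\<S> j) \<noteq> \<zero>"
proof
  assume z: "nines (\<S> j) = \<zero>"
  have "num 10 \<up> j \<prec> num 10 \<up> j \<otimes> num 10"
    using assms by (intro less_ten_times exp_neq_zero) auto
  then have "num 10 \<up> j \<prec> \<S> \<zero>" using suc_nines(2)[of "\<S> j"] z assms by simp
  then show False using less_suc_iff_le pos_iff exp_neq_zero[of "num 10" j]
      not_less_iff_le[of "num 10 \<up> j" "\<S> \<zero>"] assms by simp
qed

lemma code_closed [simp]: "e \<in> \<omega> \<Longrightarrow> w \<in> \<omega> \<Longrightarrow> code e w \<in> \<omega>"
  using suc_nines(1)[of "len e"] by (simp add: code_def)

text \<open>The pieces are as many nines as e has digits, the separating digit 0, then e and w.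
  Nonzero nines keep the left part of every concatenation nonzero, as \<open>len_append\<close>
  requires.\<close>

lemma len_code:
  assumes e: "e \<in> \<omega>" and w: "w \<in> \<omega>"
  shows "len (code e w) = \<S> (len e \<oplus> len e) \<oplus> len w"
proof -
  obtain j where j: "j \<in> \<omega>" "len e = \<S> j" using len_cases[OF e] zero_closed by metis
  define r where "r = nines (\<S> j)"
  have r: "r \<in> \<omega>" "r \<noteq> \<zero>" "len r = \<S> j"
    using suc_nines(1)[of "\<S> j"] nines_suc_neq_zero[of j] len_nines j by (auto simp: r_def)
  \<comment> \<open>Multiplication by ten is appending the digit 0, so the separator is counted by
    \<open>len_append\<close> too.\<close>
  have r10: "append r \<zero> = r \<otimes> num 10"
    using r(1) len_zero by (simp add: append_def suc_mul)
  have "r \<otimes> num 10 \<noteq> \<zero>" "len (r \<otimes> num 10) = \<S> (\<S> j)"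
    using append_neq_zero[OF r(1,2) zero_closed] len_append[OF r(1,2) zero_closed] len_zero r(3) j(1)
    by (auto simp: r10)
  then have "len (code e w) = \<S> (\<S> j) \<oplus> len e \<oplus> len w"
    using r(1) e w append_neq_zero[of "r \<otimes> num 10" e] j(2)
    by (simp add: code_def r_def[symmetric] len_append)
  then show ?thesis using j w by simp
qed

subsection \<open>The search constant\<close>

text \<open>Two applications of \<open>len_code\<close>, to the table and to the code of the theory,
  leave \<open>len L\<close> plus a summand independent of L.\<close>

lemma search_const_eq:
  assumes c: "c \<in> \<omega>"
  shows "search_const p c = \<S> (len (num p) \<oplus> len (num p)) \<oplus> \<S> (len c \<oplus> len c)" (is "_ = ?C")
  unfolding search_const_def
proof (rule the_equality)
  have eq: "len (search_code p c L) = len L \<oplus> ?C" if "L \<in> \<omega>" for L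
    using that c by (simp add: search_code_def len_code add_ac)
  with c show "?C \<in> \<omega> \<and> (\<forall>L\<in>\<omega>. len (search_code p c L) = len L \<oplus> ?C)" by simp
  fix C assume C: "C \<in> \<omega> \<and> (\<forall>L\<in>\<omega>. len (search_code p c L) = len L \<oplus> C)"
  \<comment> \<open>The instance L = 0 alone determines the constant, by cancellation.\<close>
  then have "C \<oplus> len \<zero> = ?C \<oplus> len \<zero>"
    using eq[OF zero_closed] add_commute[of _ "len \<zero>"] c by auto
  then show "C = ?C" using add_right_cancel[of C ?C "len \<zero>"] C c by auto
qed

lemma search_const_closed [simp]: "c \<in> \<omega> \<Longrightarrow> search_const p c \<in> \<omega>"
  by (simp add: search_const_eq)

text \<open>The witness 10^(C+1) has C+2 digits, and (C+2) + C = 2(C+1) < 10(C+1), which is at most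
  10^C times 10 because C < 10^C.\<close>

lemma ex_len_add_less:
  assumes C: "C \<in> \<omega>" shows "\<exists>L\<in>\<omega>. len L \<oplus> C \<prec> L"
proof (rule bexI[of _ "num 10 \<up> \<S> C"])
  have "len (num 10 \<up> \<S> C) = \<S> (\<S> C)"
    using less_ten_times[of "num 10 \<up> \<S> C"] exp_neq_zero[of "num 10" "\<S> C"] C
    by (intro len_eqI) auto
  then have "len (num 10 \<up> \<S> C) \<oplus> C = \<S> C \<oplus> \<S> C" using C by simp
  also have "\<S> C \<oplus> \<S> C \<prec> \<S> C \<otimes> num 10" using C by (intro double_less_ten_times) auto
  finally have "len (num 10 \<up> \<S> C) \<oplus> C \<prec> \<S> C \<otimes> num 10" .
  moreover have "\<S> C \<otimes> num 10 \<preceq> num 10 \<up> C \<otimes> num 10"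
    using less_ten_exp[OF C] suc_le_iff C by (intro mul_right_mono) auto
  ultimately show "len (num 10 \<up> \<S> C) \<oplus> C \<prec> num 10 \<up> \<S> C"
    using less_le_trans[of "len (num 10 \<up> \<S> C) \<oplus> C" "\<S> C \<otimes> num 10" "num 10 \<up> \<S> C"] C by simp
qed (use C in simp)

lemma ex_least_len_add_less:
  assumes C: "C \<in> \<omega>"
  obtains m where "m \<in> \<omega>" "len m \<oplus> C \<prec> m" "\<And>j. j \<in> \<omega> \<Longrightarrow> len j \<oplus> C \<prec> j \<Longrightarrow> m \<preceq> j"
proof -
  have D: "Def (\<lambda>v. len (v 0) \<oplus> v 1 \<prec> v 0)" by (intro Def_intros Term_len)
  obtain L where "L \<in> \<omega>" "len L \<oplus> C \<prec> L" using ex_len_add_less[OF C] by blast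
  then show thesis by (rule ex_least[of "\<lambda>L C. len L \<oplus> C \<prec> L", OF D _ C]) (rule that)
qed

end

section \<open>The natural numbers of a model satisfy definable induction\<close>

context zf_model
begin

text \<open>The defining predicate has to be right only on numbers. This suits the operations, whose
  descriptions are under control only there.\<close>

definition omega_definable :: "((nat \<Rightarrow> 'a) \<Rightarrow> bool) \<Rightarrow> bool" where
  "omega_definable P \<longleftrightarrow>
     (\<exists>Q. definable Q \<and> (\<forall>v. range v \<subseteq> omega_elems \<longrightarrow> (P v \<longleftrightarrow> Q v)))"

lemma omega_definableI: "definable P \<Longrightarrow> omega_definable P"
  unfolding omega_definable_def by blast

lemma omega_definableE:
  assumes "omega_definable P"
  obtains Q where "definable Q" "\<And>v. range v \<subseteq> omega_elems \<Longrightarrow> P v \<longleftrightarrow> Q v"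
  using assms unfolding omega_definable_def by blast

lemma omega_definable_cong:
  "omega_definable Q \<Longrightarrow> (\<And>v. range v \<subseteq> omega_elems \<Longrightarrow> P v \<longleftrightarrow> Q v) \<Longrightarrow> omega_definable P"
  unfolding omega_definable_def by simp

lemma omega_definable_rename:
  assumes "omega_definable P" shows "omega_definable (\<lambda>v. P (\<lambda>i. v (\<sigma> i)))"
proof -
  obtain Q where Q: "definable Q" "\<And>v. range v \<subseteq> omega_elems \<Longrightarrow> P v \<longleftrightarrow> Q v"
    using assms by (rule omega_definableE) blast
  have "P (\<lambda>i. v (\<sigma> i)) \<longleftrightarrow> Q (\<lambda>i. v (\<sigma> i))" if "range v \<subseteq> omega_elems" for v
    using that by (intro Q(2)) auto
  with omega_definableI[OF definable_rename[OF Q(1)]] show ?thesis by (rule omega_definable_cong)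
qed

lemma omega_definable_not: "omega_definable P \<Longrightarrow> omega_definable (\<lambda>v. \<not> P v)"
  unfolding omega_definable_def using definable_not by metis

lemma omega_definable_imp:
  assumes "omega_definable P" "omega_definable P'" shows "omega_definable (\<lambda>v. P v \<longrightarrow> P' v)"
proof -
  obtain Q where Q: "definable Q" "\<And>v. range v \<subseteq> omega_elems \<Longrightarrow> P v \<longleftrightarrow> Q v"
    using assms(1) by (rule omega_definableE) blast
  obtain Q' where Q': "definable Q'" "\<And>v. range v \<subseteq> omega_elems \<Longrightarrow> P' v \<longleftrightarrow> Q' v"
    using assms(2) by (rule omega_definableE) blast
  from omega_definableI[OF definable_imp[OF Q(1) Q'(1)]] show ?thesis
    by (rule omega_definable_cong) (simp add: Q(2) Q'(2))
qed

lemma omega_definable_all: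
  assumes "omega_definable (\<lambda>v. R (\<lambda>i. v (Suc i)) (v 0))"
  shows "omega_definable (\<lambda>v. \<forall>x\<in>omega_elems. R v x)"
proof -
  obtain Q where Q: "definable Q"
      "\<And>v. range v \<subseteq> omega_elems \<Longrightarrow> R (\<lambda>i. v (Suc i)) (v 0) \<longleftrightarrow> Q v"
    using assms by (rule omega_definableE) blast
  \<comment> \<open>This trivial identity rewrites Q into a function of the variable 0 and the
    shifted assignment, the shape that \<open>definable_all\<close> expects.\<close>
  have "(\<lambda>n. case n of 0 \<Rightarrow> v 0 | Suc i \<Rightarrow> v (Suc i)) = v" for v :: "nat \<Rightarrow> 'a"
    by (auto split: nat.split)
  then have "definable (\<lambda>v. v 0 \<in> omega_elems \<longrightarrow> Q (\<lambda>n. case n of 0 \<Rightarrow> v 0 | Suc i \<Rightarrow> v (Suc i)))"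
    using definable_imp[OF definable_elem_omega Q(1), of 0] by simp
  then have "definable (\<lambda>v. \<forall>x\<in>U. x \<in> omega_elems \<longrightarrow> Q (\<lambda>n. case n of 0 \<Rightarrow> x | Suc i \<Rightarrow> v i))"
    by (rule definable_all)
  then show ?thesis
  proof (rule omega_definable_cong[OF omega_definableI])
    fix v :: "nat \<Rightarrow> 'a" assume v: "range v \<subseteq> omega_elems"
    have "R v x \<longleftrightarrow> Q (\<lambda>n. case n of 0 \<Rightarrow> x | Suc i \<Rightarrow> v i)" if "x \<in> omega_elems" for x
      using Q(2)[of "\<lambda>n. case n of 0 \<Rightarrow> x | Suc i \<Rightarrow> v i"] v that
      by (simp add: image_subset_iff split: nat.split)
    then show "(\<forall>x\<in>omega_elems. R v x) \<longleftrightarrow>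
        (\<forall>x\<in>U. x \<in> omega_elems \<longrightarrow> Q (\<lambda>n. case n of 0 \<Rightarrow> x | Suc i \<Rightarrow> v i))"
      using omega_elems_in_U by blast
  qed
qed

lemma omega_definable_empty_set: "omega_definable (\<lambda>v. empty_set = v i)"
  by (rule omega_definable_cong[OF omega_definableI[OF definable_is_empty[of i]]])
    (auto simp: is_empty_iff)

lemma omega_definable_succ_set: "omega_definable (\<lambda>v. succ_set (v i) = v j)"
proof (rule omega_definable_cong[OF omega_definableI[OF definable_is_succ[of i j]]])
  fix v :: "nat \<Rightarrow> 'a" assume "range v \<subseteq> omega_elems"
  then have "v i \<in> U" using omega_elems_in_U by blast
  then show "succ_set (v i) = v j \<longleftrightarrow> is_succ (v i) (v j)" by (auto simp: is_succ_iff)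
qed

section \<open>Recursion equations and definability of recursive functions\<close>

lemma total_map_iff:
  "total_map g \<longleftrightarrow> (\<forall>m\<in>U. m \<in> omega_elems \<longrightarrow>
     (\<exists>y\<in>U. maps g m y \<and> (\<forall>z\<in>U. maps g m z \<longrightarrow> z = y)))"
  unfolding total_map_def using omega_elems_in_U by blast

lemma definable_total_map: "definable (\<lambda>v. total_map (v i))"
  unfolding total_map_iff by (intro definable_set_intros definable_elem_omega)

text \<open>The step function carries one parameter c, which is what multiplication and
  exponentiation need; addition ignores it. Definability of the result feeds the next recursion,
  where this function becomes the step.\<close>

lemma recursion_omega:
  assumes h: "\<And>y c. y \<in> omega_elems \<Longrightarrow> c \<in> omega_elems \<Longrightarrow> h y c \<in> omega_elems"
    and D: "omega_definable (\<lambda>v. h (v 0) (v 1) = v 2)"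
  shows recursion_closed_omega: "\<And>a c n. a \<in> omega_elems \<Longrightarrow> c \<in> omega_elems \<Longrightarrow> n \<in> omega_elems \<Longrightarrow>
      recursion a (\<lambda>y. h y c) n \<in> omega_elems"
    and recursion_empty_set: "\<And>a c. a \<in> omega_elems \<Longrightarrow> c \<in> omega_elems \<Longrightarrow>
      recursion a (\<lambda>y. h y c) empty_set = a"
    and recursion_succ_set: "\<And>a c n. a \<in> omega_elems \<Longrightarrow> c \<in> omega_elems \<Longrightarrow> n \<in> omega_elems \<Longrightarrow>
      recursion a (\<lambda>y. h y c) (succ_set n) = h (recursion a (\<lambda>y. h y c) n) c"
    and omega_definable_recursion:
      "omega_definable (\<lambda>v. recursion (v i) (\<lambda>y. h y (v j)) (v k) = v l)"
proof -
  obtain Q where Q: "definable Q"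
      "\<And>v. range v \<subseteq> omega_elems \<Longrightarrow> h (v 0) (v 1) = v 2 \<longleftrightarrow> Q v"
    using D by (rule omega_definableE) blast
  \<comment> \<open>The graph of h has its variables in the order argument, parameter, value, while
    \<open>recursion_rel_closed\<close> passes argument, value, parameter.\<close>
  define R where "R y z c = Q (\<lambda>i. if i = 0 then y else if i = 1 then c else z)" for y z c
  have "(\<lambda>i::nat. v (if i = 0 then 0 else if i = 1 then 2 else 1)) =
      (\<lambda>i. if i = 0 then v 0 else if i = 1 then v 2 else v 1)" for v :: "nat \<Rightarrow> 'a"
    by auto
  then have R: "definable (\<lambda>v. R (v 0) (v 1) (v 2))"
    using definable_rename[OF Q(1), of "\<lambda>i. if i = 0 then 0 else if i = 1 then 2 else 1"]
    by (simp only: R_def)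
  have Rh: "R y z c \<longleftrightarrow> z = h y c" if "y \<in> omega_elems" "z \<in> omega_elems" "c \<in> omega_elems" for y z c
    using Q(2)[of "\<lambda>i. if i = 0 then y else if i = 1 then c else z"] that
    by (auto simp: R_def image_subset_iff)
  have ex_graph: "\<exists>g\<in>U. total_map g \<and> recursion_closed a (\<lambda>y. h y c) g \<and>
      (\<forall>n\<in>omega_elems. recursion a (\<lambda>y. h y c) n \<in> omega_elems \<and> maps g n (recursion a (\<lambda>y. h y c) n))"
    if a: "a \<in> omega_elems" and c: "c \<in> omega_elems" for a c
  proof -
    obtain g where g: "g \<in> U" "total_map g" "recursion_closed a (\<lambda>y. h y c) g"
        "\<And>x y. x \<in> U \<Longrightarrow> y \<in> U \<Longrightarrow> maps g x y \<Longrightarrow> y \<in> omega_elems"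
      using ex_recursion_graph[of R c "\<lambda>y. h y c" a, OF R Rh[OF _ _ c] a c h[OF _ c]] by blast
    have "recursion a (\<lambda>y. h y c) n \<in> omega_elems" "maps g n (recursion a (\<lambda>y. h y c) n)"
      if "n \<in> omega_elems" for n
      by (rule recursion_graph[of g]; use g a h c that in blast)+
    then show ?thesis using g(1-3) by blast
  qed
  show closed: "recursion a (\<lambda>y. h y c) n \<in> omega_elems"
    if "a \<in> omega_elems" "c \<in> omega_elems" "n \<in> omega_elems" for a c n
    using ex_graph[of a c] that by blast
  show "recursion a (\<lambda>y. h y c) empty_set = a" if ac: "a \<in> omega_elems" "c \<in> omega_elems" for a c
  proof -
    obtain g where g: "total_map g" "recursion_closed a (\<lambda>y. h y c) g"
        "maps g empty_set (recursion a (\<lambda>y. h y c) empty_set)"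
      using ex_graph[OF ac] empty_set_in_omega by blast
    then have "maps g empty_set a" unfolding recursion_closed_def by blast
    then show ?thesis using total_map_unique[OF g(1) empty_set_in_omega] g(3) closed ac
      by (simp add: omega_elems_in_U)
  qed
  show "recursion a (\<lambda>y. h y c) (succ_set n) = h (recursion a (\<lambda>y. h y c) n) c"
    if ac: "a \<in> omega_elems" "c \<in> omega_elems" and n: "n \<in> omega_elems" for a c n
  proof -
    obtain g where g: "total_map g" "recursion_closed a (\<lambda>y. h y c) g"
        "\<And>n. n \<in> omega_elems \<Longrightarrow> maps g n (recursion a (\<lambda>y. h y c) n)"
      using ex_graph[OF ac] by blast
    have "maps g (succ_set n) (h (recursion a (\<lambda>y. h y c) n) c)"
      using g(2,3) n closed[OF ac n] unfolding recursion_closed_def by blast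
    then show ?thesis
      using total_map_unique[OF g(1) succ_set_in_omega[OF n]] g(3)[OF succ_set_in_omega[OF n]]
        closed ac n h by (simp add: omega_elems_in_U)
  qed
  \<comment> \<open>The graph depends on a and c, so it is quantified in the formula instead of
    being a parameter; any set satisfying the conditions gives the same value.\<close>
  have graph_iff: "recursion a (\<lambda>y. h y c) n = m \<longleftrightarrow>
      (\<exists>g\<in>U. total_map g \<and> recursion_rel_closed R g a c \<and> maps g n m)"
    if a: "a \<in> omega_elems" and c: "c \<in> omega_elems" and n: "n \<in> omega_elems" and m: "m \<in> omega_elems"
    for a c n m
  proof -
    have rel_iff: "recursion_rel_closed R r a c \<longleftrightarrow> recursion_closed a (\<lambda>y. h y c) r" for r
      by (rule recursion_rel_closed_iff) (use Rh h c in blast)+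
    obtain g where g: "g \<in> U" "total_map g" "recursion_closed a (\<lambda>y. h y c) g"
        "maps g n (recursion a (\<lambda>y. h y c) n)"
      using ex_graph[OF a c] n by blast
    have "recursion a (\<lambda>y. h y c) n = m"
      if g': "g' \<in> U" "total_map g'" "recursion_closed a (\<lambda>y. h y c) g'" "maps g' n m" for g'
    proof -
      obtain y where y: "y \<in> U" "maps g n y" "maps g' n y"
        using recursion_closed_agree[OF g(3,1) g'(3,1) a h[OF _ c] n] by blast
      show ?thesis
        using total_map_unique[OF g(2) n omega_elems_in_U[OF closed[OF a c n]] y(1) g(4) y(2)]
          total_map_unique[OF g'(2) n omega_elems_in_U[OF m] y(1) g'(4) y(3)] by simp
    qed
    note unique = this
    show ?thesis unfolding rel_iff
    proof
      assume "recursion a (\<lambda>y. h y c) n = m"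
      then show "\<exists>g\<in>U. total_map g \<and> recursion_closed a (\<lambda>y. h y c) g \<and> maps g n m"
        using g by (intro bexI[of _ g]) auto
    next
      assume "\<exists>g\<in>U. total_map g \<and> recursion_closed a (\<lambda>y. h y c) g \<and> maps g n m"
      then show "recursion a (\<lambda>y. h y c) n = m" by (elim bexE conjE) (rule unique)
    qed
  qed
  have "definable (\<lambda>v. \<exists>g\<in>U. total_map g \<and> recursion_rel_closed R g (v i) (v j) \<and> maps g (v k) (v l))"
    by (intro definable_set_intros definable_total_map definable_recursion_rel_closed R)
  then show "omega_definable (\<lambda>v. recursion (v i) (\<lambda>y. h y (v j)) (v k) = v l)"
    by (rule omega_definable_cong[OF omega_definableI]) (intro graph_iff, auto)
qed

section \<open>The arithmetical operations of the model\<close>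

lemma plus_omega:
  "m \<in> omega_elems \<Longrightarrow> n \<in> omega_elems \<Longrightarrow> plus m n \<in> omega_elems"
  "m \<in> omega_elems \<Longrightarrow> plus m empty_set = m"
  "m \<in> omega_elems \<Longrightarrow> n \<in> omega_elems \<Longrightarrow> plus m (succ_set n) = succ_set (plus m n)"
  "omega_definable (\<lambda>v. plus (v i) (v j) = v k)"
proof -
  note r = recursion_omega[of "\<lambda>y c. succ_set y", OF _ omega_definable_succ_set]
  show "m \<in> omega_elems \<Longrightarrow> n \<in> omega_elems \<Longrightarrow> plus m n \<in> omega_elems"
    "m \<in> omega_elems \<Longrightarrow> plus m empty_set = m"
    "m \<in> omega_elems \<Longrightarrow> n \<in> omega_elems \<Longrightarrow> plus m (succ_set n) = succ_set (plus m n)"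
    using r(1-3)[of m empty_set] by (simp_all add: plus_def)
  show "omega_definable (\<lambda>v. plus (v i) (v j) = v k)"
    using r(4)[of i j k] by (simp add: plus_def)
qed

text \<open>Multiplication and exponentiation start from the fixed values 0 and 1, which are not
  variables; a quantified x constrained to equal a takes the place of the start.\<close>

lemma omega_definable_recursion_const:
  assumes h: "\<And>y c. y \<in> omega_elems \<Longrightarrow> c \<in> omega_elems \<Longrightarrow> h y c \<in> omega_elems"
    and D: "omega_definable (\<lambda>v. h (v 0) (v 1) = v 2)"
    and a: "a \<in> omega_elems" "\<And>i. omega_definable (\<lambda>v. a = v i)"
  shows "omega_definable (\<lambda>v. recursion a (\<lambda>y. h y (v j)) (v k) = v l)"
proof -
  have "omega_definable (\<lambda>v. \<forall>x\<in>omega_elems. a = x \<longrightarrow> recursion x (\<lambda>y. h y (v j)) (v k) = v l)"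
    by (intro omega_definable_all omega_definable_imp a(2) omega_definable_recursion[of h, OF h D])
  then show ?thesis by (rule omega_definable_cong) (use a(1) in blast)
qed

lemma times_omega:
  "m \<in> omega_elems \<Longrightarrow> n \<in> omega_elems \<Longrightarrow> times m n \<in> omega_elems"
  "m \<in> omega_elems \<Longrightarrow> times m empty_set = empty_set"
  "m \<in> omega_elems \<Longrightarrow> n \<in> omega_elems \<Longrightarrow> times m (succ_set n) = plus (times m n) m"
  "omega_definable (\<lambda>v. times (v i) (v j) = v k)"
  using recursion_omega(1-3)[of plus, OF plus_omega(1) plus_omega(4) empty_set_in_omega]
    omega_definable_recursion_const[of plus, OF plus_omega(1) plus_omega(4) empty_set_in_omega
      omega_definable_empty_set]
  by (simp_all add: times_def)

lemma omega_definable_one: "omega_definable (\<lambda>v. succ_set empty_set = v i)"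
proof -
  have "omega_definable (\<lambda>v. \<forall>x\<in>omega_elems. empty_set = x \<longrightarrow> succ_set x = v i)"
    by (intro omega_definable_all omega_definable_imp omega_definable_empty_set omega_definable_succ_set)
  then show ?thesis by (rule omega_definable_cong) simp
qed

lemma power_omega:
  "m \<in> omega_elems \<Longrightarrow> n \<in> omega_elems \<Longrightarrow> power m n \<in> omega_elems"
  "m \<in> omega_elems \<Longrightarrow> power m empty_set = succ_set empty_set"
  "m \<in> omega_elems \<Longrightarrow> n \<in> omega_elems \<Longrightarrow> power m (succ_set n) = times (power m n) m"
  "omega_definable (\<lambda>v. power (v i) (v j) = v k)"
  using recursion_omega(1-3)[of times, OF times_omega(1) times_omega(4)
      succ_set_in_omega[OF empty_set_in_omega]]
    omega_definable_recursion_const[of times, OF times_omega(1) times_omega(4)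
      succ_set_in_omega[OF empty_set_in_omega] omega_definable_one]
  by (simp_all add: power_def)

lemma omega_definable_induct:
  assumes "omega_definable (\<lambda>v. A (v 0))" and "A empty_set"
    and "\<And>n. n \<in> omega_elems \<Longrightarrow> A n \<Longrightarrow> A (succ_set n)" and "n \<in> omega_elems"
  shows "A n"
proof -
  obtain Q where Q: "definable Q" "\<And>v. range v \<subseteq> omega_elems \<Longrightarrow> A (v 0) \<longleftrightarrow> Q v"
    using assms(1) by (rule omega_definableE) blast
  \<comment> \<open>A depends on variable 0 alone, so Q may be evaluated at constant assignments;
    this turns it into a property of one set.\<close>
  have A: "A x \<longleftrightarrow> Q (\<lambda>_. x)" if "x \<in> omega_elems" for x using Q(2)[of "\<lambda>_. x"] that by auto
  have "definable (\<lambda>v. Q (\<lambda>_. v 0))" using definable_rename[OF Q(1), of "\<lambda>_. 0"] .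
  then have "Q (\<lambda>_. n)"
    by (rule omega_induct[of "\<lambda>x _ _ _ _. Q (\<lambda>_. x)", OF _ empty_set_in_U empty_set_in_U
          empty_set_in_U empty_set_in_U _ _ assms(4)])
      (use A assms(2,3) in auto)
  then show ?thesis using A assms(4) by blast
qed

text \<open>The order clauses of \<open>peano\<close> are membership facts about von Neumann
  numbers: nothing belongs to 0, and the elements of a successor of y are those of y together with
  y.\<close>

lemma peano_omega: "peano omega omega_definable"
proof (unfold_locales, unfold omega_def nat_structure.simps)
qed (fact empty_set_in_omega succ_set_in_omega plus_omega times_omega power_omega
    omega_definable_induct omega_definable_cong omega_definable_rename omega_definable_not
    omega_definable_imp omega_definable_all omega_definable_empty_set omega_definable_succ_set
  | rule omega_definableI definable_eq definable_elem
  | use omega_elems_in_U in \<open>simp add: succ_set_neq_empty_set not_elem_empty_set elem_succ_set\<close>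
  | use omega_elems_in_U succ_set_inj in blast)+

end

section \<open>Embeddings onto initial segments\<close>

locale initial_embedding = N1: peano N1 Def1 + N2: peano N2 Def2
  for N1 :: "'a nat_structure" and Def1 and N2 :: "'b nat_structure" and Def2 +
  fixes f :: "'a \<Rightarrow> 'b"
  assumes closed [simp]: "x \<in> nats N1 \<Longrightarrow> f x \<in> nats N2"
    and zero [simp]: "f (zero N1) = zero N2"
    and one: "f (suc N1 (zero N1)) = suc N2 (zero N2)"
    and add: "x \<in> nats N1 \<Longrightarrow> y \<in> nats N1 \<Longrightarrow> f (add N1 x y) = add N2 (f x) (f y)"
    and exp: "x \<in> nats N1 \<Longrightarrow> y \<in> nats N1 \<Longrightarrow> f (exp N1 x y) = exp N2 (f x) (f y)"
    and initial: "b \<in> nats N1 \<Longrightarrow> a \<in> nats N2 \<Longrightarrow> less N2 a (f b) \<Longrightarrow> \<exists>c\<in>nats N1. a = f c"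
begin

text \<open>The successor of x is x plus one, and both addition and one are preserved.\<close>

lemma suc [simp]: "x \<in> nats N1 \<Longrightarrow> f (suc N1 x) = suc N2 (f x)"
  using add[of x "suc N1 (zero N1)"] by (simp add: one)

lemma num [simp]: "f (N1.num n) = N2.num n"
  by (induction n) simp_all

lemma less_mono:
  assumes "x \<in> nats N1" "y \<in> nats N1" "less N1 x y" shows "less N2 (f x) (f y)"
proof -
  obtain d where d: "d \<in> nats N1" "y = add N1 x (suc N1 d)"
    using N1.less_iff_add assms by blast
  then have "add N2 (f x) (suc N2 (f d)) = f y" using assms add[of x "suc N1 d"] by simp
  then show ?thesis using N2.less_iff_add assms d by auto
qed

lemma le_mono: "x \<in> nats N1 \<Longrightarrow> y \<in> nats N1 \<Longrightarrow> N1.le x y \<Longrightarrow> N2.le (f x) (f y)"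
  using less_mono unfolding N1.le_def N2.le_def by blast

lemma less_iff:
  assumes "x \<in> nats N1" "y \<in> nats N1" shows "less N2 (f x) (f y) \<longleftrightarrow> less N1 x y"
  using less_mono[OF assms] le_mono[OF assms(2,1)] N1.not_less_iff_le[OF assms]
    N2.not_less_iff_le[OF closed[OF assms(1)] closed[OF assms(2)]] by blast

lemma le_iff:
  assumes "x \<in> nats N1" "y \<in> nats N1" shows "N2.le (f x) (f y) \<longleftrightarrow> N1.le x y"
  using less_iff[OF assms(2,1)] assms by (simp flip: N1.not_less_iff_le N2.not_less_iff_le)

text \<open>The condition \<open>P'\<close> has to match P only on the image of f: a solution below
  \<open>f m\<close> is in the image by \<open>initial\<close>, and solutions above do no harm. The
  least solution m is taken as given because an arbitrary P may have none in a nonstandard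
  structure.\<close>

lemma least_transfer:
  assumes m: "m \<in> nats N1" "P m" "\<And>j. j \<in> nats N1 \<Longrightarrow> P j \<Longrightarrow> N1.le m j"
    and P: "\<And>k. k \<in> nats N1 \<Longrightarrow> P' (f k) \<longleftrightarrow> P k"
  shows "f (N1.least P) = N2.least P'"
proof -
  have "N2.least P' = f m"
  proof (rule N2.least_eqI)
    show "f m \<in> nats N2" "P' (f m)" using m P by auto
    fix j assume j: "j \<in> nats N2" "P' j"
    show "N2.le (f m) j"
    proof (rule ccontr)
      assume "\<not> N2.le (f m) j"
      then have "less N2 j (f m)" using N2.not_less_iff_le[of j "f m"] j m by auto
      then obtain c where c: "c \<in> nats N1" "j = f c" using initial j m by blast
      then have "N1.le m c" using m(3) P j by blast
      then show False using le_iff c m(1) \<open>\<not> N2.le (f m) j\<close> by blast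
    qed
  qed
  then show ?thesis using N1.least_eqI[of m P] m by simp
qed

lemma len:
  assumes x: "x \<in> nats N1" shows "f (N1.len x) = N2.len (f x)"
  unfolding N1.len_def N2.len_def
proof (rule least_transfer)
  note len = N1.len_eq_iff[OF x N1.len_closed[OF x], THEN iffD1, OF refl]
  show "N1.len x \<in> nats N1" using x by simp
  show "N1.le (N1.num 1) (N1.len x) \<and> less N1 x (exp N1 (N1.num 10) (N1.len x))"
    using len by blast
  show "N1.le (N1.len x) j"
    if "j \<in> nats N1" "N1.le (N1.num 1) j \<and> less N1 x (exp N1 (N1.num 10) j)" for j
    using len that by blast
  show "N2.le (N2.num 1) (f k) \<and> less N2 (f x) (exp N2 (N2.num 10) (f k)) \<longleftrightarrow>
      N1.le (N1.num 1) k \<and> less N1 x (exp N1 (N1.num 10) k)" if k: "k \<in> nats N1" for k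
    using le_iff[OF N1.num_closed k, of 1] less_iff[OF x, of "exp N1 (N1.num 10) k"] exp[of "N1.num 10" k] k
    by (simp del: N1.num.simps N2.num.simps One_nat_def)
qed

lemma search_const:
  assumes c: "c \<in> nats N1" shows "f (N1.search_const p c) = N2.search_const p (f c)"
  using c by (simp add: N1.search_const_eq N2.search_const_eq add len)

text \<open>Once \<open>len\<close> and the constant are carried over, the defining inequality is
  preserved and reflected at every number of the first structure, so \<open>least_transfer\<close>
  applies.\<close>

lemma chaitin_bound:
  assumes c: "c \<in> nats N1" shows "f (N1.\<L> p c) = N2.\<L> p (f c)"
proof -
  obtain m where m: "m \<in> nats N1" "less N1 (add N1 (N1.len m) (N1.search_const p c)) m"
      "\<And>j. j \<in> nats N1 \<Longrightarrow> less N1 (add N1 (N1.len j) (N1.search_const p c)) j \<Longrightarrow> N1.le m j"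
    by (rule N1.ex_least_len_add_less[OF N1.search_const_closed[OF c, of p]]) blast
  have "less N2 (add N2 (N2.len (f k)) (N2.search_const p (f c))) (f k) \<longleftrightarrow>
      less N1 (add N1 (N1.len k) (N1.search_const p c)) k" if "k \<in> nats N1" for k
    using less_iff[of "add N1 (N1.len k) (N1.search_const p c)" k] that c by (simp add: add len search_const)
  then show ?thesis unfolding N1.\<L>_def N2.\<L>_def
    using m by (intro least_transfer[of m]) auto
qed

end

theorem mainTheorem4:
  fixes V\<^sub>1 V\<^sub>2 :: "'a set_structure"
    and f :: "'a \<Rightarrow> 'a"
    and \<phi> :: fm
    and p :: nat
    and T\<^sub>1 :: 'a
    and T T' :: "'a set"
  assumes "set_model.ZF V\<^sub>1" and "set_model.ZF V\<^sub>2"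
    and "is_set_of V\<^sub>2 V\<^sub>1"
    and "initial_segment_number_extends V\<^sub>2 V\<^sub>1 f"
    \<comment> \<open>a formalization of the statement \<open>L \<le> Kol(x)\<close> and a machine table for the proof search\<close>
    and "set_model.expresses_Kol_bound V\<^sub>1 \<phi>"
    and "set_model.expresses_Kol_bound V\<^sub>2 \<phi>"
    and "arithmetic.implements_search (\<omega>_of V\<^sub>1) \<phi> p"
    and "arithmetic.implements_search (\<omega>_of V\<^sub>2) \<phi> p"
    \<comment> \<open>the theory, as understood in the two models\<close>
    and "arithmetic.recognizes (\<omega>_of V\<^sub>1) T\<^sub>1 T"
    and "arithmetic.recognizes (\<omega>_of V\<^sub>2) (f T\<^sub>1) T'"
    and "arithmetic.consistent (\<omega>_of V\<^sub>1) T"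
    and "arithmetic.consistent (\<omega>_of V\<^sub>2) T'"
  shows "f (arithmetic.\<L> (\<omega>_of V\<^sub>1) p T\<^sub>1) = arithmetic.\<L> (\<omega>_of V\<^sub>2) p (f T\<^sub>1)"
proof -
  interpret V1: zf_model V\<^sub>1 using assms(1) by unfold_locales
  interpret V2: zf_model V\<^sub>2 using assms(2) by unfold_locales
  interpret initial_embedding V1.omega V1.omega_definable V2.omega V2.omega_definable f
    using V1.peano_omega V2.peano_omega assms(4)
    by (auto simp: initial_embedding_def initial_embedding_axioms_def
        initial_segment_number_extends_def Let_def)
  show ?thesis
    \<comment> \<open>That \<open>T\<^sub>1\<close> is a number of the first model is part of
      \<open>recognizes\<close>.\<close>
    using assms(9) by (intro chaitin_bound) (simp add: arithmetic.recognizes_def)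
qed

end
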